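(* The problem FIXB restricted to instances with $m=2$ machines and with a fixed job sequence can be solved to optimality in polynomial time for arbitrarily many operations. That is, there is an algorithm which, given any FIXB instance with two machines, $n$ jobs $J_1,\dots,J_n$ that must be processed in this order, and arbitrary numbers $q_1,\dots,q_n$ of operations of the jobs (all being part of the input), computes assignment modes for the jobs and starting times yielding a feasible schedule of minimum makespan among all feasible schedules with job sequence $J_1,\dots,J_n$, in time polynomial in the input size.
   Context: The problem FIXB (Flow shop with Inter-stage Flexibility and Blocking) is defined as follows. Instance. There are $m$ machines $M_1,\dots,M_m$ arranged in this order in a flow line, and $n$ jobs $J_1,\dots,J_n$. Job $J_j$ is an ordered sequence of operations $\langle o_{1j},\dots,o_{q_jj}\rangle$, $q_j\ge m$, to be processed in this order. Each operation $o_{ij}$ has a set $M(o_{ij})$ of machines able to process it, which is either a single machine $\{M_k\}$ or a pair of consecutive machines $\{M_k,M_{k+1}\}$ (in the latter case $o_{ij}$ is called shiftable). For every job and every machine $M_k$ there is exactly one operation with $M(o_{ij})=\{M_k\}$; the operations of each job are ordered consistently with the line: first the operation with set $\{M_1\}$, then all (possibly zero) operations with set $\{M_1,M_2\}$, then the operation with set $\{M_2\}$, then those with set $\{M_2,M_3\}$, and so on, ending with the operation with set $\{M_m\}$. (For $m=2$: the first operation can only be processed on $M_1$, the last only on $M_2$, and all others are shiftable.) For each $M_k\in M(o_{ij})$ a processing time $p_{ij}^k>0$ is given. For complexity statements, processing times are rational numbers encoded in binary. Assignment mode. An assignment mode of job $J_j$ assigns each operation $o_{ij}$ to exactly one machine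 of $M(o_{ij})$ such that the machine indices are nondecreasing in $i$. (For $m=2$ this means choosing $l_j\in\{1,\dots,q_j-1\}$, the first $l_j$ operations being processed on $M_1$ and the remaining $q_j-l_j$ on $M_2$.) Given an assignment mode, $P_j^k$ denotes the sum of the processing times $p_{ij}^k$ over all operations of $J_j$ assigned to $M_k$. Feasible schedule. A feasible schedule consists of an assignment mode for each job, a permutation of the jobs (the same on all machines; in the fixed-sequence version it is prescribed to be $J_1,\dots,J_n$), and starting times $s_{h,k}\ge 0$ of the job in position $h$ on machine $M_k$ such that, writing $P_{h,k}$ for the total processing time on $M_k$ of the job in position $h$: $s_{h,k+1}\ge s_{h,k}+P_{h,k}$ for $1\le h\le n$, $1\le k\le m-1$; $s_{h+1,k}\ge s_{h,k}+P_{h,k}$ for $1\le h\le n-1$, $1\le k\le m$; and $s_{h,k}\ge s_{h-1,k+1}$ for $2\le h\le n$, $1\le k\le m-1$ (blocking: there are no buffers, so a job occupies $M_k$ until it starts on $M_{k+1}$). Objective. Minimize the makespan $C_{\max}=s_{n,m}+P_{n,m}$. *)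

theory Defs
  imports
    Complex_Main
    "HOL-Library.Log_Nat"
    "HOL-Combinatorics.Permutations"
    "HOL-Computational_Algebra.Polynomial"
begin

section \<open>The flow shop problem FIXB\<close>

text \<open>
  Machines, jobs, positions in the job sequence and operations of a job are all numbered from 0.
  \<open>Fixed k p\<close> is an operation with machine set \<open>{k}\<close> and processing time \<open>p\<close>;
  \<open>Shiftable k p p'\<close> has machine set \<open>{k, k + 1}\<close>, with processing time \<open>p\<close> on machine \<open>k\<close>
  and \<open>p'\<close> on machine \<open>k + 1\<close>.
\<close>

datatype operation = Fixed nat rat | Shiftable nat rat rat

fun machine_set :: "operation \<Rightarrow> nat set" where
  "machine_set (Fixed k p) = {k}"
| "machine_set (Shiftable k p p') = {k, k + 1}"

text \<open>The value of \<open>ptime x k\<close> is meaningful only for \<open>k \<in> machine_set x\<close>.\<close>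

fun ptime :: "operation \<Rightarrow> nat \<Rightarrow> rat" where
  "ptime (Fixed k p) l = p"
| "ptime (Shiftable k p p') l = (if l = k then p else p')"

record fixb =
  machines :: nat
  jobs :: "operation list list"

abbreviation njobs :: "fixb \<Rightarrow> nat" where
  "njobs I \<equiv> length (jobs I)"

text \<open>
  The sum of the smallest and the largest machine index is \<open>2 * k\<close> for the set \<open>{k}\<close> and
  \<open>2 * k + 1\<close> for \<open>{k, k + 1}\<close>. Sorting by it gives the order
  \<open>{0}, {0, 1}, \<dots>, {0, 1}, {1}, {1, 2}, \<dots>\<close> of the operations along the line.
\<close>

definition fixb_job :: "nat \<Rightarrow> operation list \<Rightarrow> bool" where
  "fixb_job m ops \<longleftrightarrow>
     (\<forall>x \<in> set ops. machine_set x \<subseteq> {..<m} \<and> (\<forall>k \<in> machine_set x. ptime x k > 0)) \<and>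
     (\<forall>k<m. \<exists>!i. i < length ops \<and> machine_set (ops ! i) = {k}) \<and>
     sorted (map (\<lambda>x. Min (machine_set x) + Max (machine_set x)) ops)"

definition fixb_instance :: "fixb \<Rightarrow> bool" where
  "fixb_instance I \<longleftrightarrow>
     machines I \<ge> 1 \<and> njobs I \<ge> 1 \<and> (\<forall>ops \<in> set (jobs I). fixb_job (machines I) ops)"

definition assignment_mode :: "operation list \<Rightarrow> (nat \<Rightarrow> nat) \<Rightarrow> bool" where
  "assignment_mode ops a \<longleftrightarrow>
     (\<forall>i < length ops. a i \<in> machine_set (ops ! i)) \<and> mono_on {..<length ops} a"

definition total_ptime :: "operation list \<Rightarrow> (nat \<Rightarrow> nat) \<Rightarrow> nat \<Rightarrow> rat" where
  "total_ptime ops a k = (\<Sum>i | i < length ops \<and> a i = k. ptime (ops ! i) k)"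

text \<open>
  \<open>mode S j i\<close> is the machine of operation \<open>i\<close> of job \<open>j\<close>, \<open>job_at S h\<close> the job in position \<open>h\<close>,
  and \<open>start S h k\<close> the starting time on machine \<open>k\<close> of the job in position \<open>h\<close>.
\<close>

record schedule =
  mode :: "nat \<Rightarrow> nat \<Rightarrow> nat"
  job_at :: "nat \<Rightarrow> nat"
  start :: "nat \<Rightarrow> nat \<Rightarrow> real"

definition pos_ptime :: "fixb \<Rightarrow> schedule \<Rightarrow> nat \<Rightarrow> nat \<Rightarrow> real" where
  "pos_ptime I S h k =
     real_of_rat (total_ptime (jobs I ! job_at S h) (mode S (job_at S h)) k)"

definition feasible :: "fixb \<Rightarrow> schedule \<Rightarrow> bool" where
  "feasible I S \<longleftrightarrow>
     (\<forall>j < njobs I. assignment_mode (jobs I ! j) (mode S j)) \<and>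
     job_at S permutes {..<njobs I} \<and>
     (\<forall>h k. h < njobs I \<and> k < machines I \<longrightarrow> start S h k \<ge> 0) \<and>
     (\<forall>h k. h < njobs I \<and> k + 1 < machines I \<longrightarrow>
        start S h (k + 1) \<ge> start S h k + pos_ptime I S h k) \<and>
     (\<forall>h k. h + 1 < njobs I \<and> k < machines I \<longrightarrow>
        start S (h + 1) k \<ge> start S h k + pos_ptime I S h k) \<and>
     (\<forall>h k. h + 1 < njobs I \<and> k + 1 < machines I \<longrightarrow>
        start S (h + 1) k \<ge> start S h (k + 1))"

definition makespan :: "fixb \<Rightarrow> schedule \<Rightarrow> real" where
  "makespan I S =
     start S (njobs I - 1) (machines I - 1) + pos_ptime I S (njobs I - 1) (machines I - 1)"

definition feasible_fixed_seq :: "fixb \<Rightarrow> schedule \<Rightarrow> bool" where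
  "feasible_fixed_seq I S \<longleftrightarrow> feasible I S \<and> job_at S = id"

definition optimal_fixed_seq :: "fixb \<Rightarrow> schedule \<Rightarrow> bool" where
  "optimal_fixed_seq I S \<longleftrightarrow>
     feasible_fixed_seq I S \<and> (\<forall>S'. feasible_fixed_seq I S' \<longrightarrow> makespan I S \<le> makespan I S')"


section \<open>Polynomial-time computation\<close>

text \<open>
  The machine model is the random access machine with addition, subtraction, multiplication and
  comparison under the logarithmic cost criterion, which is polynomially equivalent to the
  multitape Turing machine (Cook and Reckhow; Aho, Hopcroft and Ullman). Programs are
  written in structured form, and a program may use finitely many named memory banks,
  each a sequence of cells holding natural numbers.
\<close>

datatype expr =
  Const nat
| Cell string expr
| Add expr expr
| Sub expr expr
| Mul expr expr

datatype test =
  Less expr expr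
| Neg test
| Conj test test

datatype prog =
  Skip
| Store string expr expr
| Seq prog prog
| Cond test prog prog
| While test prog

type_synonym store = "string \<Rightarrow> nat \<Rightarrow> nat"

fun val :: "expr \<Rightarrow> store \<Rightarrow> nat" where
  "val (Const c) s = c"
| "val (Cell x e) s = s x (val e s)"
| "val (Add e1 e2) s = val e1 s + val e2 s"
| "val (Sub e1 e2) s = val e1 s - val e2 s"
| "val (Mul e1 e2) s = val e1 s * val e2 s"

fun holds :: "test \<Rightarrow> store \<Rightarrow> bool" where
  "holds (Less e1 e2) s \<longleftrightarrow> val e1 s < val e2 s"
| "holds (Neg b) s \<longleftrightarrow> \<not> holds b s"
| "holds (Conj b1 b2) s \<longleftrightarrow> holds b1 s \<and> holds b2 s"

text \<open>The length of a binary numeral together with a separator.\<close>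

definition bits :: "nat \<Rightarrow> nat" where
  "bits x = Suc (floorlog 2 x)"

definition bits_list :: "nat list \<Rightarrow> nat" where
  "bits_list xs = sum_list (map bits xs)"

text \<open>
  Evaluating an expression costs the total length of all intermediate values, including
  the addresses used and the final value.
\<close>

fun expr_cost :: "expr \<Rightarrow> store \<Rightarrow> nat" where
  "expr_cost (Const c) s = bits c"
| "expr_cost (Cell x e) s = expr_cost e s + bits (val (Cell x e) s)"
| "expr_cost (Add e1 e2) s = expr_cost e1 s + expr_cost e2 s + bits (val (Add e1 e2) s)"
| "expr_cost (Sub e1 e2) s = expr_cost e1 s + expr_cost e2 s + bits (val (Sub e1 e2) s)"
| "expr_cost (Mul e1 e2) s = expr_cost e1 s + expr_cost e2 s + bits (val (Mul e1 e2) s)"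

fun test_cost :: "test \<Rightarrow> store \<Rightarrow> nat" where
  "test_cost (Less e1 e2) s = expr_cost e1 s + expr_cost e2 s + 1"
| "test_cost (Neg b) s = test_cost b s + 1"
| "test_cost (Conj b1 b2) s = test_cost b1 s + test_cost b2 s + 1"

text \<open>\<open>exec c s t s'\<close>: started in \<open>s\<close>, the program \<open>c\<close> terminates in \<open>s'\<close> at cost \<open>t\<close>.\<close>

inductive exec :: "prog \<Rightarrow> store \<Rightarrow> nat \<Rightarrow> store \<Rightarrow> bool" where
  Skip: "exec Skip s 1 s"
| Store: "exec (Store x e1 e2) s (expr_cost e1 s + expr_cost e2 s + 1)
            (s(x := (s x)(val e1 s := val e2 s)))"
| Seq: "exec c1 s1 t1 s2 \<Longrightarrow> exec c2 s2 t2 s3 \<Longrightarrow> exec (Seq c1 c2) s1 (t1 + t2 + 1) s3"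
| CondTrue: "holds b s \<Longrightarrow> exec c1 s t s' \<Longrightarrow> exec (Cond b c1 c2) s (test_cost b s + t + 1) s'"
| CondFalse: "\<not> holds b s \<Longrightarrow> exec c2 s t s' \<Longrightarrow> exec (Cond b c1 c2) s (test_cost b s + t + 1) s'"
| WhileFalse: "\<not> holds b s \<Longrightarrow> exec (While b c) s (test_cost b s + 1) s"
| WhileTrue: "holds b s1 \<Longrightarrow> exec c s1 t1 s2 \<Longrightarrow> exec (While b c) s2 t2 s3 \<Longrightarrow>
    exec (While b c) s1 (test_cost b s1 + t1 + t2 + 1) s3"

text \<open>
  The input and output words occupy the cells \<open>1, 2, \<dots>\<close> of their memory banks, and
  their number is kept in cell \<open>0\<close>. All other cells are initially \<open>0\<close>.
\<close>

definition input_store :: "nat list \<Rightarrow> store" where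
  "input_store xs = (\<lambda>_ _. 0)
     (''input'' := (\<lambda>i. if i \<le> length xs then (length xs # xs) ! i else 0))"

definition output_words :: "store \<Rightarrow> nat list" where
  "output_words s = map (s ''output'') [1..<Suc (s ''output'' 0)]"

text \<open>
  A search problem consists of a set of instances, an encoding of the instances, and a relation
  telling which output words are correct answers. The length of the output
  is charged in addition to the running time, as cells are \<open>0\<close> without being written.
\<close>

definition poly_time_solvable ::
  "'i set \<Rightarrow> ('i \<Rightarrow> nat list) \<Rightarrow> ('i \<Rightarrow> nat list \<Rightarrow> bool) \<Rightarrow> bool" where
  "poly_time_solvable Inst enc answer \<longleftrightarrow>
     (\<exists>(c :: prog) (p :: nat poly). \<forall>I \<in> Inst. \<exists>t s.
        exec c (input_store (enc I)) t s \<and>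
        t + bits_list (output_words s) \<le> poly p (bits_list (enc I)) \<and>
        answer I (output_words s))"


section \<open>Encoding of instances and schedules\<close>

text \<open>
  Only nonnegative rationals are encoded; numerator and denominator are written in lowest terms.
\<close>

definition encode_rat :: "rat \<Rightarrow> nat list" where
  "encode_rat r = [nat (fst (quotient_of r)), nat (snd (quotient_of r))]"

fun encode_operation :: "operation \<Rightarrow> nat list" where
  "encode_operation (Fixed k p) = [0, k] @ encode_rat p"
| "encode_operation (Shiftable k p p') = [1, k] @ encode_rat p @ encode_rat p'"

definition encode_job :: "operation list \<Rightarrow> nat list" where
  "encode_job ops = length ops # concat (map encode_operation ops)"

definition encode_fixb :: "fixb \<Rightarrow> nat list" where
  "encode_fixb I = [machines I, njobs I] @ concat (map encode_job (jobs I))"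

text \<open>
  A schedule for a prescribed job sequence is written as the list of the machines of all
  operations, job by job, followed by the starting times, position by position.
  The fractions representing the starting times need not be in lowest terms.
\<close>

definition encodes_schedule :: "fixb \<Rightarrow> schedule \<Rightarrow> nat list \<Rightarrow> bool" where
  "encodes_schedule I S ys \<longleftrightarrow>
     (\<exists>num den :: nat \<Rightarrow> nat \<Rightarrow> nat.
        (\<forall>h k. h < njobs I \<and> k < machines I \<longrightarrow>
           den h k > 0 \<and> start S h k = real (num h k) / real (den h k)) \<and>
        ys = concat (map (\<lambda>j. map (mode S j) [0..<length (jobs I ! j)]) [0..<njobs I]) @
             concat (map (\<lambda>h. concat (map (\<lambda>k. [num h k, den h k]) [0..<machines I])) [0..<njobs I]))"

end

theory Submission
  imports Defs
begin

text \<open>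
  With two machines a job delays its successor by the larger of its own time on the second machine
  and the time of the successor on the first one, as blocking lets the successor enter the first
  machine only when the job leaves it. The minimum makespan is therefore a shortest path in a
  layered graph whose vertices are the operations at which the jobs move to the second machine.
  Scaled by the product of all denominators, the arc lengths are integers, and the shortest path is
  found by a backward dynamic program over all pairs of operations.
\<close>

section \<open>Step counts and logarithmic cost\<close>

text \<open>The graph is small because a job on two machines has no more assignment modes than
  operations, and because the choice for a job interacts only with those for its two neighbours. One
  nondecreasing sequence of times t_0, ..., t_n then describes a best schedule: t_h is the start of
  job h on the first machine and at the same time that of job h - 1 on the second. The obstacle is
  the cost model rather than the optimisation. The logarithmic criterion charges for the length of
  every intermediate value, and the common denominator is as long as all denominators together. Time
  is therefore counted in steps that do not depend on the values, and lengths are accounted for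
  once, for all programs of a certain shape. The machine also has neither division nor a maximum,
  which explains the form of the scaling and of the arc costs.\<close>

fun esize :: "expr \<Rightarrow> nat" where
  "esize (Const c) = Suc c"
| "esize (Cell x e) = Suc (esize e)"
| "esize (Add e1 e2) = Suc (esize e1 + esize e2)"
| "esize (Sub e1 e2) = Suc (esize e1 + esize e2)"
| "esize (Mul e1 e2) = Suc (esize e1 + esize e2)"

fun tsize :: "test \<Rightarrow> nat" where
  "tsize (Less e1 e2) = Suc (esize e1 + esize e2)"
| "tsize (Neg b) = Suc (tsize b)"
| "tsize (Conj b1 b2) = Suc (tsize b1 + tsize b2)"

text \<open>This is \<open>exec\<close> with the logarithmic cost replaced by the size of the syntax
  that is evaluated. The count does not look at values, so step bounds can be proved loop by loop
  and are turned into cost only once, in \<open>run_exec\<close>.\<close>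

inductive run :: "prog \<Rightarrow> store \<Rightarrow> nat \<Rightarrow> store \<Rightarrow> bool" where
  run_Skip: "run Skip s 1 s"
| run_Store: "run (Store x e1 e2) s (Suc (esize e1 + esize e2))
    (s(x := (s x)(val e1 s := val e2 s)))"
| run_Seq: "run c1 s1 k1 s2 \<Longrightarrow> run c2 s2 k2 s3 \<Longrightarrow> run (Seq c1 c2) s1 (Suc (k1 + k2)) s3"
| run_CondTrue: "holds b s \<Longrightarrow> run c1 s k s' \<Longrightarrow> run (Cond b c1 c2) s (Suc (tsize b + k)) s'"
| run_CondFalse: "\<not> holds b s \<Longrightarrow> run c2 s k s' \<Longrightarrow> run (Cond b c1 c2) s (Suc (tsize b + k)) s'"
| run_WhileFalse: "\<not> holds b s \<Longrightarrow> run (While b c) s (Suc (tsize b)) s"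
| run_WhileTrue: "holds b s1 \<Longrightarrow> run c s1 k1 s2 \<Longrightarrow> run (While b c) s2 k2 s3 \<Longrightarrow>
    run (While b c) s1 (Suc (tsize b + k1 + k2)) s3"

text \<open>
  Multiplication is only allowed with a factor whose length stays bounded by that of the input,
  so that every step lengthens the numbers by a bounded amount only. This makes it unnecessary to
  bound the values a program computes: the cost is polynomial in the number of steps.
\<close>

definition factor_banks :: "string set" where
  "factor_banks = {''input'', ''den''}"

text \<open>The bound 8 is \<open>2 ^ 3\<close> and goes with the hypothesis
  \<open>3 \<le> B\<close> used below; the program multiplies by no constant larger than 4.\<close>

fun factor_expr :: "expr \<Rightarrow> bool" where
  "factor_expr (Const c) \<longleftrightarrow> c < 8"
| "factor_expr (Cell x e) \<longleftrightarrow> x \<in> factor_banks"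
| "factor_expr _ \<longleftrightarrow> False"

fun tame_expr :: "expr \<Rightarrow> bool" where
  "tame_expr (Const c) \<longleftrightarrow> True"
| "tame_expr (Cell x e) \<longleftrightarrow> tame_expr e"
| "tame_expr (Add e1 e2) \<longleftrightarrow> tame_expr e1 \<and> tame_expr e2"
| "tame_expr (Sub e1 e2) \<longleftrightarrow> tame_expr e1 \<and> tame_expr e2"
| "tame_expr (Mul e1 e2) \<longleftrightarrow> tame_expr e1 \<and> tame_expr e2 \<and> (factor_expr e1 \<or> factor_expr e2)"

fun tame_test :: "test \<Rightarrow> bool" where
  "tame_test (Less e1 e2) \<longleftrightarrow> tame_expr e1 \<and> tame_expr e2"
| "tame_test (Neg b) \<longleftrightarrow> tame_test b"
| "tame_test (Conj b1 b2) \<longleftrightarrow> tame_test b1 \<and> tame_test b2"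

fun tame :: "prog \<Rightarrow> bool" where
  "tame Skip \<longleftrightarrow> True"
| "tame (Store x e1 e2) \<longleftrightarrow> tame_expr e1 \<and> tame_expr e2 \<and> (x \<in> factor_banks \<longrightarrow> factor_expr e2)"
| "tame (Seq c1 c2) \<longleftrightarrow> tame c1 \<and> tame c2"
| "tame (Cond b c1 c2) \<longleftrightarrow> tame_test b \<and> tame c1 \<and> tame c2"
| "tame (While b c) \<longleftrightarrow> tame_test b \<and> tame c"

text \<open>\<open>M\<close> grows along a run while \<open>B\<close> stays fixed:
  \<open>tame\<close> lets only factors be stored in the factor banks, so a multiplication by one of
  them adds at most \<open>B\<close> bits however long the run is.\<close>

definition store_bounded :: "nat \<Rightarrow> nat \<Rightarrow> store \<Rightarrow> bool" where
  "store_bounded B M s \<longleftrightarrow>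
     (\<forall>x i. s x i < 2 ^ M) \<and> (\<forall>x \<in> factor_banks. \<forall>i. s x i < 2 ^ B)"

lemma bits_le_if_less_power: "x < 2 ^ k \<Longrightarrow> bits x \<le> Suc k"
  by (simp add: bits_def floorlog_leI)

lemma less_power_bits: "x < 2 ^ bits x"
proof -
  have "x < 2 ^ floorlog 2 x"
    by (metis floorlog_bounds less_numeral_extra(1) not_gr_zero one_less_numeral_iff power_eq_0_iff semiring_norm(76) zero_less_power zero_neq_numeral)
  also have "\<dots> \<le> 2 ^ bits x"
    by (simp add: bits_def)
  finally show ?thesis .
qed

lemma factor_expr_less:
  assumes "factor_expr e" "store_bounded B M s" "3 \<le> B"
  shows "val e s < 2 ^ B"
proof (cases e)
  case (Const c)
  then have "c < 2 ^ 3" using assms by simp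
  also have "(2::nat) ^ 3 \<le> 2 ^ B" using assms(3) by (rule power_increasing) simp
  finally show ?thesis using Const by simp
qed (use assms in \<open>auto simp: store_bounded_def\<close>)

text \<open>Each node of the expression adds at most \<open>Suc B\<close> bits: an addition one, a
  multiplication by a factor \<open>B\<close>, a subtraction none. Hence lengths are linear in the
  size even for nested products.\<close>

lemma val_less:
  assumes "tame_expr e" "store_bounded B M s" "3 \<le> B"
  shows "val e s < 2 ^ (M + Suc B * esize e)"
  using assms(1)
proof (induction e)
  case (Const c)
  \<comment> \<open>\<open>esize\<close> charges a constant its value, so this crude bound is good
    enough.\<close>
  have "c < 2 ^ c" by (rule less_exp)
  also have "(2::nat) ^ c \<le> 2 ^ (M + Suc B * Suc c)"
    by (rule power_increasing) (auto simp: algebra_simps)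
  finally show ?case by simp
next
  case (Cell x e)
  have "s x (val e s) < 2 ^ M" using assms(2) by (simp add: store_bounded_def)
  also have "(2::nat) ^ M \<le> 2 ^ (M + Suc B * esize (Cell x e))"
    by (rule power_increasing) auto
  finally show ?case by simp
next
  case (Add e1 e2)
  let ?m = "M + Suc B * (esize e1 + esize e2)"
  have "val e1 s < 2 ^ ?m" "val e2 s < 2 ^ ?m"
    using Add by (auto intro: less_le_trans[OF _ power_increasing] simp: algebra_simps)
  then have "val (Add e1 e2) s < 2 ^ Suc ?m" by simp
  also have "(2::nat) ^ Suc ?m \<le> 2 ^ (M + Suc B * esize (Add e1 e2))"
    by (rule power_increasing) auto
  finally show ?case .
next
  case (Sub e1 e2)
  have "val (Sub e1 e2) s \<le> val e1 s" by simp
  also have "\<dots> < 2 ^ (M + Suc B * esize e1)" using Sub by simp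
  also have "\<dots> \<le> 2 ^ (M + Suc B * esize (Sub e1 e2))"
    by (intro power_increasing add_left_mono mult_le_mono2) auto
  finally show ?case .
next
  case (Mul e1 e2)
  have less: "x * y < 2 ^ (M + Suc B * esize (Mul e1 e2))"
    if "x < 2 ^ (M + Suc B * k)" "y < 2 ^ B" "k = esize e1 \<or> k = esize e2" for x y k :: nat
  proof -
    have "x * y < 2 ^ (M + Suc B * k) * 2 ^ B"
      using that by (intro mult_strict_mono) auto
    also have "\<dots> = 2 ^ (M + Suc B * k + B)" by (simp add: power_add)
    also have "\<dots> \<le> 2 ^ (M + Suc B * esize (Mul e1 e2))"
      using that(3) by (intro power_increasing) (auto simp: algebra_simps)
    finally show ?thesis .
  qed
  show ?case
    using Mul less[of "val e1 s" "esize e1" "val e2 s"] less[of "val e2 s" "esize e2" "val e1 s"]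
      factor_expr_less[OF _ assms(2,3)] by (auto simp: mult.commute)
qed

text \<open>\<open>k\<close> is kept apart from \<open>esize e\<close> so that one bound on the
  length of values serves all subexpressions in the induction; at most \<open>esize e\<close> nodes
  are charged that length.\<close>

lemma expr_cost_le:
  assumes "tame_expr e" "store_bounded B M s" "3 \<le> B" "esize e \<le> k"
  shows "expr_cost e s \<le> esize e * (M + Suc B * k + 1)"
proof -
  have bits: "bits (val f s) \<le> M + Suc B * k + 1" if "tame_expr f" "esize f \<le> k" for f
  proof -
    have "val f s < 2 ^ (M + Suc B * esize f)" using that assms val_less by blast
    also have "\<dots> \<le> 2 ^ (M + Suc B * k)"
      using that by (intro power_increasing add_left_mono mult_le_mono2) auto
    finally have "bits (val f s) \<le> Suc (M + Suc B * k)" by (rule bits_le_if_less_power)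
    then show ?thesis by simp
  qed
  show ?thesis
    using assms(1,4)
  proof (induction e)
    case (Const c)
    then show ?case using bits[of "Const c"] by simp
  next
    case (Cell x e)
    then show ?case using bits[of "Cell x e"] by simp
  next
    case (Add e1 e2)
    then show ?case using bits[of "Add e1 e2"] by (simp add: add_mult_distrib)
  next
    case (Sub e1 e2)
    then show ?case using bits[of "Sub e1 e2"] by (simp add: add_mult_distrib)
  next
    case (Mul e1 e2)
    then show ?case using bits[of "Mul e1 e2"] by (simp add: add_mult_distrib)
  qed
qed

lemma test_cost_le:
  assumes "tame_test b" "store_bounded B M s" "3 \<le> B" "tsize b \<le> k"
  shows "test_cost b s \<le> tsize b * (M + Suc B * k + 1)"
  using assms(1,4)
proof (induction b)
  case (Less e1 e2)
  then show ?case
    using expr_cost_le[OF _ assms(2,3), of e1 k] expr_cost_le[OF _ assms(2,3), of e2 k]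
    by (simp add: add_mult_distrib)
qed (auto simp: add_mult_distrib)

lemma store_bounded_mono: "store_bounded B M s \<Longrightarrow> M \<le> M' \<Longrightarrow> store_bounded B M' s"
  unfolding store_bounded_def by (meson less_le_trans one_le_numeral power_increasing)

text \<open>Boundedness and cost need one joint induction, as the cost of a step depends on how far
  earlier steps have lengthened the values. Generalising \<open>M\<close> lets the second half of a
  sequence or loop start from the store left by the first. Of the final 2, one unit is the separator
  in \<open>bits\<close> and one the flat charge of a construct.\<close>

lemma run_exec:
  assumes "run c s k s'" "tame c" "store_bounded B M s" "3 \<le> B"
  shows "store_bounded B (M + Suc B * k) s' \<and>
    (\<exists>t. exec c s t s' \<and> t \<le> k * (M + Suc B * k + 2))"
  using assms(1-3)
proof (induction arbitrary: M)
  case (run_Skip s)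
  then show ?case by (auto intro!: exI[of _ 1] exec.Skip elim!: store_bounded_mono)
next
  case (run_Store x e1 e2 s)
  let ?k = "Suc (esize e1 + esize e2)"
  have "val e2 s < 2 ^ (M + Suc B * esize e2)"
    using run_Store val_less[OF _ _ assms(4)] by auto
  also have "\<dots> \<le> 2 ^ (M + Suc B * ?k)"
    by (intro power_increasing add_left_mono mult_le_mono2) auto
  finally have "store_bounded B (M + Suc B * ?k) (s(x := (s x)(val e1 s := val e2 s)))"
    using run_Store store_bounded_mono[of B M s "M + Suc B * ?k"]
      factor_expr_less[of e2 B M s] assms(4)
    by (auto simp: store_bounded_def simp del: mult_Suc)
  moreover have "expr_cost e1 s \<le> esize e1 * (M + Suc B * ?k + 1)"
    "expr_cost e2 s \<le> esize e2 * (M + Suc B * ?k + 1)"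
    by (rule expr_cost_le[OF _ _ assms(4)]; use run_Store in simp)+
  then have "expr_cost e1 s + expr_cost e2 s + 1 \<le> ?k * (M + Suc B * ?k + 2)"
    by (simp add: algebra_simps)
  ultimately show ?case using exec.Store by blast
next
  case (run_Seq c1 s1 k1 s2 c2 k2 s3)
  from run_Seq obtain t1 where 1: "store_bounded B (M + Suc B * k1) s2" "exec c1 s1 t1 s2"
    "t1 \<le> k1 * (M + Suc B * k1 + 2)" by (metis tame.simps(3))
  from run_Seq 1(1) obtain t2 where 2: "store_bounded B (M + Suc B * k1 + Suc B * k2) s3"
    "exec c2 s2 t2 s3" "t2 \<le> k2 * (M + Suc B * k1 + Suc B * k2 + 2)" by (metis tame.simps(3))
  let ?m = "M + Suc B * Suc (k1 + k2) + 2"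
  have "t1 \<le> k1 * ?m" by (rule order.trans[OF 1(3)], rule mult_le_mono2) (simp add: algebra_simps)
  moreover have "t2 \<le> k2 * ?m" by (rule order.trans[OF 2(3)], rule mult_le_mono2) (simp add: algebra_simps)
  ultimately have "t1 + t2 + 1 \<le> Suc (k1 + k2) * ?m" by (simp add: add_mult_distrib)
  moreover have "store_bounded B (M + Suc B * Suc (k1 + k2)) s3"
    by (rule store_bounded_mono[OF 2(1)]) (simp add: algebra_simps)
  ultimately show ?case using exec.Seq[OF 1(2) 2(2)] by blast
next
  case (run_CondTrue b s c1 k s' c2)
  from run_CondTrue obtain t1 where 1: "store_bounded B (M + Suc B * k) s'" "exec c1 s t1 s'"
    "t1 \<le> k * (M + Suc B * k + 2)" by (metis tame.simps(4))
  let ?m = "M + Suc B * Suc (tsize b + k) + 2"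
  have "t1 \<le> k * ?m" by (rule order.trans[OF 1(3)], rule mult_le_mono2) (simp add: algebra_simps)
  moreover have "test_cost b s \<le> tsize b * (M + Suc B * Suc (tsize b + k) + 1)"
    using run_CondTrue by (intro test_cost_le[OF _ _ assms(4)]) auto
  then have "test_cost b s \<le> tsize b * ?m" by simp
  ultimately have "test_cost b s + t1 + 1 \<le> Suc (tsize b + k) * ?m" by (simp add: add_mult_distrib)
  moreover have "store_bounded B (M + Suc B * Suc (tsize b + k)) s'"
    by (rule store_bounded_mono[OF 1(1)]) (simp add: algebra_simps)
  ultimately show ?case using exec.CondTrue[OF run_CondTrue(1) 1(2)] by blast
next
  case (run_CondFalse b s c2 k s' c1)
  from run_CondFalse obtain t1 where 1: "store_bounded B (M + Suc B * k) s'" "exec c2 s t1 s'"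
    "t1 \<le> k * (M + Suc B * k + 2)" by (metis tame.simps(4))
  let ?m = "M + Suc B * Suc (tsize b + k) + 2"
  have "t1 \<le> k * ?m" by (rule order.trans[OF 1(3)], rule mult_le_mono2) (simp add: algebra_simps)
  moreover have "test_cost b s \<le> tsize b * (M + Suc B * Suc (tsize b + k) + 1)"
    using run_CondFalse by (intro test_cost_le[OF _ _ assms(4)]) auto
  then have "test_cost b s \<le> tsize b * ?m" by simp
  ultimately have "test_cost b s + t1 + 1 \<le> Suc (tsize b + k) * ?m" by (simp add: add_mult_distrib)
  moreover have "store_bounded B (M + Suc B * Suc (tsize b + k)) s'"
    by (rule store_bounded_mono[OF 1(1)]) (simp add: algebra_simps)
  ultimately show ?case using exec.CondFalse[OF run_CondFalse(1) 1(2)] by blast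
next
  case (run_WhileFalse b s c)
  let ?m = "M + Suc B * Suc (tsize b) + 2"
  have "test_cost b s \<le> tsize b * (M + Suc B * Suc (tsize b) + 1)"
    using run_WhileFalse by (intro test_cost_le[OF _ _ assms(4)]) auto
  then have "test_cost b s + 1 \<le> Suc (tsize b) * ?m" by (simp add: add_mult_distrib)
  moreover have "store_bounded B (M + Suc B * Suc (tsize b)) s"
    using run_WhileFalse(3) by (rule store_bounded_mono) simp
  ultimately show ?case using exec.WhileFalse[OF run_WhileFalse(1)] by blast
next
  case (run_WhileTrue b s1 c k1 s2 k2 s3)
  from run_WhileTrue obtain t1 where 1: "store_bounded B (M + Suc B * k1) s2" "exec c s1 t1 s2"
    "t1 \<le> k1 * (M + Suc B * k1 + 2)" by (metis tame.simps(5))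
  from run_WhileTrue 1(1) obtain t2 where 2: "store_bounded B (M + Suc B * k1 + Suc B * k2) s3"
    "exec (While b c) s2 t2 s3" "t2 \<le> k2 * (M + Suc B * k1 + Suc B * k2 + 2)" by meson
  let ?k = "Suc (tsize b + k1 + k2)"
  let ?m = "M + Suc B * ?k + 2"
  have "t1 \<le> k1 * ?m" by (rule order.trans[OF 1(3)], rule mult_le_mono2) (simp add: algebra_simps)
  moreover have "t2 \<le> k2 * ?m" by (rule order.trans[OF 2(3)], rule mult_le_mono2) (simp add: algebra_simps)
  moreover have "test_cost b s1 \<le> tsize b * (M + Suc B * ?k + 1)"
    using run_WhileTrue by (intro test_cost_le[OF _ _ assms(4)]) auto
  then have "test_cost b s1 \<le> tsize b * ?m" by simp
  ultimately have "test_cost b s1 + t1 + t2 + 1 \<le> ?k * ?m" by (simp add: add_mult_distrib)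
  moreover have "store_bounded B (M + Suc B * ?k) s3"
    by (rule store_bounded_mono[OF 2(1)]) (simp add: algebra_simps)
  ultimately show ?case using exec.WhileTrue[OF run_WhileTrue(1) 1(2) 2(2)] by blast
qed

section \<open>Hoare-style rules with frame conditions and a step budget\<close>

fun writes :: "prog \<Rightarrow> string set" where
  "writes Skip = {}"
| "writes (Store x e1 e2) = {x}"
| "writes (Seq c1 c2) = writes c1 \<union> writes c2"
| "writes (Cond b c1 c2) = writes c1 \<union> writes c2"
| "writes (While b c) = writes c"

lemma run_frame: "run c s k s' \<Longrightarrow> x \<notin> writes c \<Longrightarrow> s' x = s x"
  by (induction rule: run.induct) auto

definition runs :: "prog \<Rightarrow> nat \<Rightarrow> (store \<Rightarrow> bool) \<Rightarrow> store \<Rightarrow> bool" where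
  "runs c n Q s \<longleftrightarrow> (\<exists>k\<le>n. \<exists>s'. run c s k s' \<and> Q s')"

text \<open>The new postcondition may use that banks outside \<open>writes c\<close> are unchanged,
  so a specification only has to mention the banks that its program changes.\<close>

lemma runs_mono:
  "runs c n Q s \<Longrightarrow> n \<le> n' \<Longrightarrow>
    (\<And>s'. Q s' \<Longrightarrow> (\<And>x. x \<notin> writes c \<Longrightarrow> s' x = s x) \<Longrightarrow> Q' s') \<Longrightarrow> runs c n' Q' s"
  unfolding runs_def by (meson order.trans run_frame)

text \<open>The budget is consumed from the left, so a chain of commands can be verified in order
  against one given total. The premise \<open>n1 < n\<close> guards the truncated
  difference.\<close>

lemma runs_Seq:
  assumes "runs c1 n1 Q s"
    "\<And>s'. Q s' \<Longrightarrow> (\<And>x. x \<notin> writes c1 \<Longrightarrow> s' x = s x) \<Longrightarrow> runs c2 (n - Suc n1) R s'"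
    "n1 < n"
  shows "runs (Seq c1 c2) n R s"
proof -
  obtain k1 s' where 1: "k1 \<le> n1" "run c1 s k1 s'" "Q s'"
    using assms(1) unfolding runs_def by blast
  moreover have "runs c2 (n - Suc n1) R s'"
    using assms(2)[OF 1(3)] run_frame[OF 1(2)] by blast
  then obtain k2 s'' where "k2 \<le> n - Suc n1" "run c2 s' k2 s''" "R s''"
    unfolding runs_def by blast
  moreover have "Suc (k1 + k2) \<le> n" using assms(3) 1(1) \<open>k2 \<le> n - Suc n1\<close> by linarith
  ultimately show ?thesis unfolding runs_def using run_Seq by blast
qed

fun straight :: "prog \<Rightarrow> bool" where
  "straight Skip \<longleftrightarrow> True"
| "straight (Store x e1 e2) \<longleftrightarrow> True"
| "straight (Seq c1 c2) \<longleftrightarrow> straight c1 \<and> straight c2"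
| "straight (Cond b c1 c2) \<longleftrightarrow> straight c1 \<and> straight c2"
| "straight (While b c) \<longleftrightarrow> False"

fun effect :: "prog \<Rightarrow> store \<Rightarrow> store" where
  "effect Skip s = s"
| "effect (Store x e1 e2) s = s(x := (s x)(val e1 s := val e2 s))"
| "effect (Seq c1 c2) s = effect c2 (effect c1 s)"
| "effect (Cond b c1 c2) s = (if holds b s then effect c1 s else effect c2 s)"
| "effect (While b c) s = s"

fun length_bound :: "prog \<Rightarrow> nat" where
  "length_bound Skip = 1"
| "length_bound (Store x e1 e2) = Suc (esize e1 + esize e2)"
| "length_bound (Seq c1 c2) = Suc (length_bound c1 + length_bound c2)"
| "length_bound (Cond b c1 c2) = Suc (tsize b + length_bound c1 + length_bound c2)"
| "length_bound (While b c) = 1"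

text \<open>Loop-free code always terminates, so its final store is computed by simplification of
  \<open>effect\<close>, whose clause for \<open>While\<close> is a dummy. Charging both branches of
  a conditional avoids a maximum in the budget.\<close>

lemma runs_straight:
  assumes "straight c" "Q (effect c s)" "length_bound c \<le> n"
  shows "runs c n Q s"
proof -
  have "\<exists>k\<le>length_bound c. run c s k (effect c s)"
    using assms(1)
  proof (induction c arbitrary: s)
    case Skip
    then show ?case using run_Skip by (metis effect.simps(1) length_bound.simps(1) order.refl)
  next
    case (Store x e1 e2)
    then show ?case
      using run_Store by (metis effect.simps(2) length_bound.simps(2) order.refl)
  next
    case (Seq c1 c2)
    then obtain k1 k2 where "k1 \<le> length_bound c1" "run c1 s k1 (effect c1 s)"
      "k2 \<le> length_bound c2" "run c2 (effect c1 s) k2 (effect (Seq c1 c2) s)"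
      by (metis effect.simps(3) straight.simps(3))
    then show ?case by (auto intro!: exI[of _ "Suc (k1 + k2)"] run_Seq)
  next
    case (Cond b c1 c2)
    then obtain k1 k2 where "k1 \<le> length_bound c1" "run c1 s k1 (effect c1 s)"
      "k2 \<le> length_bound c2" "run c2 s k2 (effect c2 s)"
      by (metis straight.simps(4))
    then have "\<exists>k\<le>max k1 k2. run (if holds b s then c1 else c2) s k (effect (Cond b c1 c2) s)"
      by (intro exI[of _ "if holds b s then k1 else k2"]) auto
    then obtain k where "k \<le> max k1 k2"
      "run (if holds b s then c1 else c2) s k (effect (Cond b c1 c2) s)" by blast
    then have "run (Cond b c1 c2) s (Suc (tsize b + k)) (effect (Cond b c1 c2) s)"
      by (cases "holds b s") (auto intro: run_CondTrue run_CondFalse)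
    moreover have "Suc (tsize b + k) \<le> length_bound (Cond b c1 c2)"
      using \<open>k \<le> max k1 k2\<close> \<open>k1 \<le> length_bound c1\<close> \<open>k2 \<le> length_bound c2\<close>
      by simp
    ultimately show ?case by blast
  qed auto
  then show ?thesis unfolding runs_def using assms(2,3) order.trans by blast
qed

lemma runs_Seq_straight:
  assumes "straight c1" "length_bound c1 < n" "runs c2 (n - Suc (length_bound c1)) Q (effect c1 s)"
  shows "runs (Seq c1 c2) n Q s"
proof (rule runs_Seq[OF runs_straight])
  show "runs c2 (n - Suc (length_bound c1)) Q s'" if "s' = effect c1 s" for s'
    using that assms(3) by simp
qed (use assms in auto)

abbreviation var :: "string \<Rightarrow> expr" where
  "var x \<equiv> Cell x (Const 0)"

abbreviation assign :: "string \<Rightarrow> expr \<Rightarrow> prog" where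
  "assign x e \<equiv> Store x (Const 0) e"

definition upto_loop :: "string \<Rightarrow> expr \<Rightarrow> prog \<Rightarrow> prog" where
  "upto_loop v e c = While (Less (var v) e) (Seq c (assign v (Add (var v) (Const 1))))"

lemma writes_upto_loop [simp]: "writes (upto_loop v e c) = insert v (writes c)"
  by (auto simp: upto_loop_def)

lemma tame_upto_loop [simp]:
  "tame (upto_loop v e c) \<longleftrightarrow> tame_expr e \<and> tame c \<and> v \<notin> factor_banks"
  by (auto simp: upto_loop_def)

text \<open>The bound \<open>e\<close> is evaluated anew in each round, hence the premise that
  invariant and frame determine its value. The invariant for \<open>Suc i\<close> is demanded of the
  store after the increment. Around the body a round costs \<open>esize e + 12\<close>:
  \<open>esize e + 3\<close> for the test, 7 for the increment, 2 for \<open>Seq\<close> and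
  \<open>While\<close>; the failing test at the end costs \<open>esize e + 4\<close>.\<close>

lemma runs_upto_loop:
  assumes init: "s v 0 = m" "m \<le> N" "I m s"
    and bound: "\<And>i s'. I i s' \<Longrightarrow> s' v 0 = i \<Longrightarrow> (\<And>x. x \<notin> insert v (writes c) \<Longrightarrow> s' x = s x) \<Longrightarrow>
      val e s' = N"
    and step: "\<And>i s'. I i s' \<Longrightarrow> s' v 0 = i \<Longrightarrow> m \<le> i \<Longrightarrow> i < N \<Longrightarrow>
      (\<And>x. x \<notin> insert v (writes c) \<Longrightarrow> s' x = s x) \<Longrightarrow>
      runs c n (\<lambda>s''. s'' v 0 = i \<and> I (Suc i) (s''(v := (s'' v)(0 := Suc i)))) s'"
    and final: "\<And>s'. I N s' \<Longrightarrow> s' v 0 = N \<Longrightarrow>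
      (\<And>x. x \<notin> insert v (writes c) \<Longrightarrow> s' x = s x) \<Longrightarrow> Q s'"
    and time: "(N - m) * (n + esize e + 12) + esize e + 4 \<le> k"
  shows "runs (upto_loop v e c) k Q s"
proof -
  let ?T = "\<lambda>d. d * (n + esize e + 12) + esize e + 4"
  have "\<exists>k\<le>?T (N - i). \<exists>s''. run (upto_loop v e c) s' k s'' \<and> I N s'' \<and> s'' v 0 = N"
    if "I i s'" "s' v 0 = i" "m \<le> i" "i \<le> N" "\<And>x. x \<notin> insert v (writes c) \<Longrightarrow> s' x = s x" for i s'
    using that
  proof (induction "N - i" arbitrary: i s')
    case 0
    then have "i = N" by simp
    have "val e s' = N" using 0 bound by blast
    then have "run (upto_loop v e c) s' (Suc (tsize (Less (var v) e))) s'"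
      unfolding upto_loop_def using 0 \<open>i = N\<close> by (intro run_WhileFalse) simp
    then show ?case using 0 \<open>i = N\<close> by (auto intro!: exI[of _ "Suc (tsize (Less (var v) e))"])
  next
    case (Suc d)
    then have "i < N" by simp
    have e: "val e s' = N" using Suc bound by blast
    from step[OF Suc(3-5) \<open>i < N\<close> Suc(7)] obtain k1 s1 where 1: "k1 \<le> n" "run c s' k1 s1"
      "s1 v 0 = i" "I (Suc i) (s1(v := (s1 v)(0 := Suc i)))" unfolding runs_def by blast
    let ?s2 = "s1(v := (s1 v)(0 := Suc i))"
    have "run (Seq c (assign v (Add (var v) (Const 1)))) s' (Suc (k1 + 7)) ?s2"
      using run_Seq[OF 1(2) run_Store, of v "Const 0" "Add (var v) (Const 1)"] 1(3)
      by (simp add: numeral_eq_Suc)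
    note while = run_WhileTrue[OF _ this, of "Less (var v) e"]
    have fr: "?s2 x = s x" if "x \<notin> insert v (writes c)" for x
      using that run_frame[OF 1(2), of x] Suc(7)[of x] by auto
    have "\<exists>k\<le>?T (N - Suc i). \<exists>s''. run (upto_loop v e c) ?s2 k s'' \<and> I N s'' \<and> s'' v 0 = N"
      using \<open>i < N\<close> Suc.hyps(2) Suc.prems(3) fr by (intro Suc.hyps(1) 1(4)) auto
    then obtain k2 s3 where 2: "k2 \<le> ?T (N - Suc i)" "run (upto_loop v e c) ?s2 k2 s3"
      "I N s3" "s3 v 0 = N" by blast
    have "run (upto_loop v e c) s' (Suc (tsize (Less (var v) e) + Suc (k1 + 7) + k2)) s3"
      using while 2(2) Suc(4) e \<open>i < N\<close> unfolding upto_loop_def by simp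
    moreover have "N - i = Suc (N - Suc i)" using \<open>i < N\<close> by simp
    then have "Suc (tsize (Less (var v) e) + Suc (k1 + 7) + k2) \<le> ?T (N - i)"
      using 1(1) 2(1) by simp
    ultimately show ?case using 2(3,4) by blast
  qed
  from this[OF init(3,1) order.refl init(2)] obtain k' s' where *: "k' \<le> ?T (N - m)"
    "run (upto_loop v e c) s k' s'" "I N s'" "s' v 0 = N" by blast
  have "Q s'" using final[OF *(3,4)] run_frame[OF *(2)] by simp
  with * time show ?thesis unfolding runs_def using order.trans by blast
qed

section \<open>Scaling to a common denominator\<close>

fun block :: "prog list \<Rightarrow> prog" where
  "block [] = Skip"
| "block [c] = c"
| "block (c # d # cs) = Seq c (block (d # cs))"

abbreviation equal :: "expr \<Rightarrow> expr \<Rightarrow> test" where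
  "equal e1 e2 \<equiv> Conj (Neg (Less e1 e2)) (Neg (Less e2 e1))"

abbreviation double :: "expr \<Rightarrow> expr" where
  "double e \<equiv> Mul (Const 2) e"

text \<open>This is the budget of a loop with at most \<open>2 * W\<close> rounds of at most
  \<open>K * W\<close> steps; \<open>c + d\<close> is the cost of the failing test. The factor 2
  covers loops over both cells of every operation.\<close>

lemma quadratic_time:
  fixes m X W :: nat
  assumes "m \<le> 2 * W" "X \<le> K * W" "1 \<le> W" "2 * K + c + d \<le> C"
  shows "m * X + c + d \<le> C * (W * W)"
proof -
  have "m * X \<le> (2 * W) * (K * W)" using assms by (intro mult_le_mono)
  moreover have "c + d \<le> (c + d) * (W * W)" using assms(3) by simp
  moreover have "(2 * K + (c + d)) * (W * W) = 2 * W * (K * W) + (c + d) * (W * W)"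
    by (simp add: algebra_simps)
  moreover have "(2 * K + (c + d)) * (W * W) \<le> C * (W * W)"
    using assms(4) by (intro mult_le_mono1) simp
  ultimately show ?thesis by linarith
qed

text \<open>
  The operations of all jobs are numbered consecutively from 1. The cells \<open>2 * g\<close> and \<open>2 * g + 1\<close> of
  the banks \<open>num\<close>, \<open>den\<close> and \<open>V\<close> belong to operation \<open>g\<close> on the first and the second machine; a machine
  that cannot process \<open>g\<close> gets the fraction \<open>0 / 1\<close>. The numbers before the first and after the
  last operation act as one-operation jobs with processing time 0. Since \<open>num\<close> is set to 1 in cell 0,
  cell 0 of \<open>V\<close> receives the common denominator.
\<close>

definition multiply_loop :: prog where
  "multiply_loop = upto_loop ''y'' (double (var ''g''))
     (Cond (equal (var ''x'') (var ''y'')) Skip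
       (Store ''V'' (var ''x'') (Mul (Cell ''V'' (var ''x'')) (Cell ''den'' (var ''y'')))))"

definition scale_row :: prog where
  "scale_row = block
    [Store ''V'' (var ''x'') (Cell ''num'' (var ''x'')), assign ''y'' (Const 2), multiply_loop]"

definition scale :: prog where
  "scale = block
    [assign ''x'' (Const 0),
     upto_loop ''x'' (double (var ''g'')) scale_row,
     Store ''V'' (Add (double (var ''g'')) (Const 1)) (Const 1)]"

text \<open>Without division, the quotient of the common denominator by \<open>den x\<close> is
  formed as the product of all other denominators. The range begins at 2 because cells 0 and 1 of
  \<open>den\<close> are never written and hold 0.\<close>

lemma multiply_loop:
  assumes "s ''y'' 0 = 2" "1 \<le> s ''g'' 0" "s ''g'' 0 \<le> W"
  shows "runs multiply_loop (100 * W) (\<lambda>s'. s' ''V'' = (s ''V'')(s ''x'' 0 :=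
    s ''V'' (s ''x'' 0) * (\<Prod>y\<in>{2..<2 * s ''g'' 0} - {s ''x'' 0}. s ''den'' y))) s"
proof -
  define x where "x = s ''x'' 0"
  define P where "P i = (\<Prod>y\<in>{2..<i} - {x}. s ''den'' y)" for i
  have P: "P (Suc i) = (if i = x then P i else P i * s ''den'' i)" if "2 \<le> i" for i
  proof -
    have "{2..<Suc i} - {x} = (if i = x then {2..<i} - {x} else insert i ({2..<i} - {x}))"
      using that by auto
    then show ?thesis by (simp add: P_def mult.commute)
  qed
  show ?thesis
    unfolding multiply_loop_def
  proof (rule runs_upto_loop[where m = 2 and N = "2 * s ''g'' 0" and n = 30 and
        I = "\<lambda>i s'. s' ''V'' = (s ''V'')(x := s ''V'' x * P i)"])
    show "s ''V'' = (s ''V'')(x := s ''V'' x * P 2)" by (simp add: P_def)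
  next
    fix i s' assume *: "s' ''V'' = (s ''V'')(x := s ''V'' x * P i)" "s' ''y'' 0 = i" "2 \<le> i"
      and fr: "\<And>z. z \<notin> insert ''y'' (writes (Cond (equal (var ''x'') (var ''y'')) Skip
       (Store ''V'' (var ''x'') (Mul (Cell ''V'' (var ''x'')) (Cell ''den'' (var ''y'')))))) \<Longrightarrow>
         s' z = s z"
    show "runs (Cond (equal (var ''x'') (var ''y'')) Skip
       (Store ''V'' (var ''x'') (Mul (Cell ''V'' (var ''x'')) (Cell ''den'' (var ''y''))))) 30
       (\<lambda>s''. s'' ''y'' 0 = i \<and> (s''(''y'' := (s'' ''y'')(0 := Suc i))) ''V'' =
         (s ''V'')(x := s ''V'' x * P (Suc i))) s'"
      by (rule runs_straight) (use * P fr[of "''x''"] fr[of "''den''"] in \<open>auto simp: x_def\<close>)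
  next
    show "(2 * s ''g'' 0 - 2) * (30 + esize (double (var ''g'')) + 12) + esize (double (var ''g'')) + 4
       \<le> 100 * W"
      using assms by simp
  qed (use assms in \<open>auto simp: x_def P_def\<close>)
qed

lemma scale:
  assumes "1 \<le> s ''g'' 0" "s ''g'' 0 \<le> W"
  shows "runs scale (500 * (W * W)) (\<lambda>s'.
    (\<forall>x<2 * s ''g'' 0. s' ''V'' x =
      s ''num'' x * (\<Prod>y\<in>{2..<2 * s ''g'' 0} - {x}. s ''den'' y)) \<and>
    s' ''V'' (2 * s ''g'' 0 + 1) = 1) s"
proof -
  define N where "N = 2 * s ''g'' 0"
  define F where "F x = s ''num'' x * (\<Prod>y\<in>{2..<N} - {x}. s ''den'' y)" for x
  \<comment> \<open>A spare \<open>100 * (W * W)\<close> pays for the straight-line commands around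
    the loop.\<close>
  have WW: "97 \<le> 100 * (W * W)"
    using assms mult_le_mono[of 1 W 1 W] by linarith
  have w: "writes scale_row = {''y'', ''V''}"
    by (auto simp: scale_row_def multiply_loop_def)
  have row: "runs scale_row (130 * W) (\<lambda>s'. s' ''x'' = s1 ''x'' \<and> s' ''V'' = (s1 ''V'')(i := F i)) s1"
    if "s1 ''g'' = s ''g''" "s1 ''num'' = s ''num''" "s1 ''den'' = s ''den''" "s1 ''x'' 0 = i"
    for s1 i
    unfolding scale_row_def block.simps
    by (intro runs_Seq_straight runs_mono[OF multiply_loop[where W = W]])
      (use assms that in \<open>auto simp: F_def N_def multiply_loop_def\<close>)
  have loop: "runs (upto_loop ''x'' (double (var ''g'')) scale_row)
      (400 * (W * W)) (\<lambda>s'. \<forall>x<N. s' ''V'' x = F x) s1"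
    if s1: "s1 ''x'' 0 = 0" "\<And>z. z \<noteq> ''x'' \<Longrightarrow> s1 z = s z" for s1
  proof (rule runs_upto_loop[where m = 0 and N = N and n = "130 * W" and
        I = "\<lambda>i s'. \<forall>x<i. s' ''V'' x = F x"])
    show "(N - 0) * (130 * W + esize (double (var ''g'')) + 12) + esize (double (var ''g'')) + 4
       \<le> 400 * (W * W)"
      by (rule quadratic_time[where K = 150]) (use assms in \<open>simp_all add: N_def\<close>)
  next
    fix i s' assume I: "\<forall>x<i. s' ''V'' x = F x" "s' ''x'' 0 = i"
      and fr: "\<And>z. z \<notin> insert ''x'' (writes scale_row) \<Longrightarrow> s' z = s1 z"
    show "runs scale_row (130 * W) (\<lambda>s''. s'' ''x'' 0 = i \<and>
        (\<forall>x<Suc i. (s''(''x'' := (s'' ''x'')(0 := Suc i))) ''V'' x = F x)) s'"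
      by (rule runs_mono[OF row[where i = i]]) (use I fr s1 w in \<open>auto simp: less_Suc_eq\<close>)
  qed (use w s1 in \<open>auto simp: N_def\<close>)
  show ?thesis
    unfolding scale_def block.simps
  proof (rule runs_Seq_straight, goal_cases)
    case 3
    show ?case
    proof (rule runs_Seq[OF loop], goal_cases)
      case (3 s')
      have "s' ''g'' = s ''g''" using 3(2)[of "''g''"] w by simp
      then show ?case
        using 3(1) WW by (intro runs_straight) (auto simp: F_def N_def)
    qed (use WW in auto)
  qed (use WW in auto)
qed

section \<open>The dynamic program\<close>

text \<open>\<open>PA a\<close> and \<open>PB a\<close> are to become the scaled times of the job on
  the two machines if it moves on with operation \<open>a\<close>. Visiting all pairs is quadratic,
  but so is the dynamic program.\<close>

definition sums_step :: prog where
  "sums_step =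
     Cond (equal (Cell ''job'' (var ''a'')) (Cell ''job'' (var ''b'')))
       (Cond (Less (var ''b'') (var ''a''))
         (Store ''PA'' (var ''a'') (Add (Cell ''PA'' (var ''a'')) (Cell ''V'' (double (var ''b'')))))
         (Store ''PB'' (var ''a'')
           (Add (Cell ''PB'' (var ''a'')) (Cell ''V'' (Add (double (var ''b'')) (Const 1))))))
       Skip"

definition sums_row :: prog where
  "sums_row = upto_loop ''b'' (Add (var ''g'') (Const 1)) sums_step"

definition job_sums :: prog where
  "job_sums = block
    [assign ''a'' (Const 0),
     upto_loop ''a'' (Add (var ''g'') (Const 1)) (block [assign ''b'' (Const 0), sums_row])]"

text \<open>Truncation at \<open>i\<close> makes the sum an invariant of the loop over
  \<open>b\<close>. The job test selects the operations of one job without knowing where the job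
  begins or ends.\<close>

definition part_sum :: "store \<Rightarrow> (nat \<Rightarrow> bool) \<Rightarrow> nat \<Rightarrow> nat \<Rightarrow> nat \<Rightarrow> nat" where
  "part_sum s R k a i = (\<Sum>b<i. if R b \<and> s ''job'' b = s ''job'' a then s ''V'' (2 * b + k) else 0)"

lemma part_sum_0 [simp]: "part_sum s R k a 0 = 0"
  by (simp add: part_sum_def)

lemma part_sum_Suc [simp]: "part_sum s R k a (Suc i) = part_sum s R k a i +
    (if R i \<and> s ''job'' i = s ''job'' a then s ''V'' (2 * i + k) else 0)"
  by (simp add: part_sum_def)

lemma writes_sums [simp]:
  "writes sums_step = {''PA'', ''PB''}" "writes sums_row = {''b'', ''PA'', ''PB''}"
  by (auto simp: sums_step_def sums_row_def)

lemma effect_sums_step: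
  assumes "s ''a'' 0 = a" "s ''b'' 0 = b"
  shows "effect sums_step s =
    (if s ''job'' b = s ''job'' a then
       if b < a then s(''PA'' := (s ''PA'')(a := s ''PA'' a + s ''V'' (2 * b)))
       else s(''PB'' := (s ''PB'')(a := s ''PB'' a + s ''V'' (2 * b + 1)))
     else s)"
  using assms by (auto simp: sums_step_def)

lemma sums_row:
  assumes "s ''b'' 0 = 0" "s ''a'' 0 = a" "1 \<le> s ''g'' 0" "s ''g'' 0 \<le> W"
  shows "runs sums_row (200 * W) (\<lambda>s'.
    s' ''PA'' = (s ''PA'')(a := s ''PA'' a + part_sum s (\<lambda>b. b < a) 0 a (s ''g'' 0 + 1)) \<and>
    s' ''PB'' = (s ''PB'')(a := s ''PB'' a + part_sum s (\<lambda>b. a \<le> b) 1 a (s ''g'' 0 + 1))) s"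
  unfolding sums_row_def
proof (rule runs_upto_loop[where m = 0 and N = "s ''g'' 0 + 1" and n = 70 and
      I = "\<lambda>i s'. s' ''PA'' = (s ''PA'')(a := s ''PA'' a + part_sum s (\<lambda>b. b < a) 0 a i) \<and>
    s' ''PB'' = (s ''PB'')(a := s ''PB'' a + part_sum s (\<lambda>b. a \<le> b) 1 a i)"], goal_cases)
  case (5 i s')
  have fr: "s' ''a'' 0 = a" "s' ''job'' = s ''job''" "s' ''V'' = s ''V''"
    using 5(5)[of "''a''"] 5(5)[of "''job''"] 5(5)[of "''V''"] assms by simp_all
  show ?case
  proof (rule runs_straight, goal_cases)
    case 2
    show ?case
      unfolding effect_sums_step[of s' a i, OF fr(1) 5(2)] fr using 5(1,2) by auto
  qed (simp_all add: sums_step_def)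
qed (use assms in auto)

lemma job_sums:
  assumes "s ''PA'' = (\<lambda>_. 0)" "s ''PB'' = (\<lambda>_. 0)" "1 \<le> s ''g'' 0" "s ''g'' 0 \<le> W"
  shows "runs job_sums (700 * (W * W)) (\<lambda>s'. \<forall>a \<le> s ''g'' 0.
    s' ''PA'' a = part_sum s (\<lambda>b. b < a) 0 a (s ''g'' 0 + 1) \<and>
    s' ''PB'' a = part_sum s (\<lambda>b. a \<le> b) 1 a (s ''g'' 0 + 1)) s"
proof -
  have WW: "97 \<le> 100 * (W * W)"
    using assms mult_le_mono[of 1 W 1 W] by linarith
  show ?thesis
    unfolding job_sums_def block.simps
  proof (rule runs_Seq_straight, goal_cases)
    case 3
    show ?case
    proof (rule runs_upto_loop[where m = 0 and N = "s ''g'' 0 + 1" and n = "220 * W" and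
        I = "\<lambda>i s'. (\<forall>a<i. s' ''PA'' a = part_sum s (\<lambda>b. b < a) 0 a (s ''g'' 0 + 1) \<and>
          s' ''PB'' a = part_sum s (\<lambda>b. a \<le> b) 1 a (s ''g'' 0 + 1)) \<and>
          (\<forall>a\<ge>i. s' ''PA'' a = 0 \<and> s' ''PB'' a = 0)"], goal_cases)
      case (5 i s')
      show ?case
      proof (rule runs_Seq_straight, goal_cases)
        case 3
        define t where "t = effect (assign ''b'' (Const 0)) s'"
        have t: "t ''job'' = s ''job''" "t ''V'' = s ''V''" "t ''b'' 0 = 0" "t ''a'' 0 = i"
          "t ''g'' = s ''g''" "t ''PA'' = s' ''PA''" "t ''PB'' = s' ''PB''"
          using 5(5)[of "''job''"] 5(5)[of "''V''"] 5(5)[of "''g''"] 5(2) by (simp_all add: t_def)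
        then have "part_sum t = part_sum s"
          by (intro ext) (simp only: part_sum_def)
        then have "runs sums_row (200 * W) (\<lambda>s''.
            s'' ''PA'' = (s' ''PA'')(i := part_sum s (\<lambda>b. b < i) 0 i (s ''g'' 0 + 1)) \<and>
            s'' ''PB'' = (s' ''PB'')(i := part_sum s (\<lambda>b. i \<le> b) 1 i (s ''g'' 0 + 1))) t"
          using sums_row[of t i W] t assms(3,4) 5(1) by simp
        then show ?case
          unfolding t_def[symmetric]
        proof (rule runs_mono, goal_cases)
          case 1
          show ?case using assms(3,4) by simp
        next
          case (2 u)
          have "u ''a'' 0 = i" using 2(2)[of "''a''"] t by simp
          then show ?case using 2(1) 5(1) by (auto simp: less_Suc_eq)
        qed
      qed (use assms in auto)
    next
      case 7
      have "(s ''g'' 0 + 1 - 0) * (220 * W + esize (Add (var ''g'') (Const 1)) + 12) +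
        esize (Add (var ''g'') (Const 1)) + 4 \<le> 600 * (W * W)"
        by (rule quadratic_time[where K = 250]) (use assms in auto)
      also have "\<dots> \<le> 700 * (W * W) - Suc (length_bound (assign ''a'' (Const 0)))"
        using WW by simp
      finally show ?case .
    qed (use assms in auto)
  qed (use WW in auto)
qed

text \<open>
  \<open>G\<close> holds the length of a shortest path from a vertex to the end and \<open>next\<close> its first step. The value
  0 of \<open>next\<close> means that no step has been found yet, as position 0 is never the end of an arc.
  Vertices are recognised by a positive time on the second machine, hence the 1 stored at the end
  of \<open>V\<close> by \<open>scale\<close>.
\<close>

definition option_cost :: expr where
  "option_cost = Add (Add (Cell ''PA'' (var ''b''))
     (Sub (Cell ''PB'' (var ''a'')) (Cell ''PA'' (var ''b'')))) (Cell ''G'' (var ''b''))"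

definition best_choice :: prog where
  "best_choice =
     Cond (Conj (equal (Cell ''job'' (var ''b'')) (Add (Cell ''job'' (var ''a'')) (Const 1)))
         (Less (Const 0) (Cell ''V'' (Add (double (var ''b'')) (Const 1)))))
       (Cond (Conj (Less (Const 0) (Cell ''next'' (var ''a'')))
           (Neg (Less option_cost (Cell ''G'' (var ''a'')))))
         Skip
         (block [Store ''G'' (var ''a'') option_cost, Store ''next'' (var ''a'') (var ''b'')]))
       Skip"

definition best_row :: prog where
  "best_row = upto_loop ''b'' (Add (var ''g'') (Const 1)) best_choice"

definition best :: prog where
  "best = block
    [assign ''i'' (Const 0),
     upto_loop ''i'' (var ''g'') (block
       [assign ''a'' (Sub (Sub (var ''g'') (Const 1)) (var ''i'')),
        assign ''b'' (Const 0),
        best_row])]"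

definition is_option :: "store \<Rightarrow> nat \<Rightarrow> nat \<Rightarrow> bool" where
  "is_option s a b \<longleftrightarrow> b \<le> s ''g'' 0 \<and> s ''job'' b = s ''job'' a + 1 \<and> 0 < s ''V'' (2 * b + 1)"

definition step_cost :: "store \<Rightarrow> nat \<Rightarrow> nat \<Rightarrow> nat" where
  "step_cost s a b = max (s ''PA'' b) (s ''PB'' a)"

text \<open>This is the Bellman equation at \<open>a\<close>, restricted to candidates below
  \<open>i\<close>. It refers to the values of \<open>G\<close> at the ends of the arcs, so it
  persists only if these do not change later. The last branch is the initial content of the
  cells.\<close>

definition best_below :: "store \<Rightarrow> nat \<Rightarrow> (nat \<Rightarrow> nat) \<Rightarrow> (nat \<Rightarrow> nat) \<Rightarrow> nat \<Rightarrow> bool" where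
  "best_below s i nxt G a \<longleftrightarrow>
     (if \<exists>b<i. is_option s a b
      then nxt a < i \<and> is_option s a (nxt a) \<and> G a = step_cost s a (nxt a) + G (nxt a) \<and>
        (\<forall>b<i. is_option s a b \<longrightarrow> G a \<le> step_cost s a b + G b)
      else nxt a = 0 \<and> G a = 0)"

lemma writes_best [simp]:
  "writes best_choice = {''G'', ''next''}" "writes best_row = {''b'', ''G'', ''next''}"
  by (auto simp: best_choice_def best_row_def)

lemma straight_best_choice: "straight best_choice" "length_bound best_choice \<le> 120"
  by (simp_all add: best_choice_def option_cost_def)

lemma effect_best_choice:
  assumes "s ''a'' 0 = a" "s ''b'' 0 = b"
  shows "effect best_choice s =
    (if s ''job'' b = s ''job'' a + 1 \<and> 0 < s ''V'' (2 * b + 1) \<and>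
        (s ''next'' a = 0 \<or> step_cost s a b + s ''G'' b < s ''G'' a)
     then s(''G'' := (s ''G'')(a := step_cost s a b + s ''G'' b), ''next'' := (s ''next'')(a := b))
     else s)"
proof -
  \<comment> \<open>With truncated subtraction, p + (q - p) is the maximum of p and q.\<close>
  have val: "val option_cost s = step_cost s a b + s ''G'' b"
    using assms by (simp add: option_cost_def step_cost_def)
  show ?thesis
    unfolding best_choice_def effect.simps holds.simps val block.simps
    using assms by auto
qed

lemma best_row:
  assumes "s ''b'' 0 = 0" "s ''a'' 0 = a" "1 \<le> s ''g'' 0" "s ''g'' 0 \<le> W" "s ''job'' 0 = 0"
    "s ''next'' a = 0" "s ''G'' a = 0"
  shows "runs best_row (300 * W) (\<lambda>s'. best_below s (s ''g'' 0 + 1) (s' ''next'') (s' ''G'') a \<and>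
    (\<forall>c. c \<noteq> a \<longrightarrow> s' ''next'' c = s ''next'' c \<and> s' ''G'' c = s ''G'' c)) s"
proof -
  \<comment> \<open>Job numbers grow by one along an arc, so no arc enters position 0 and none is a
    loop. The former makes 0 a safe mark in \<open>next\<close>; the latter lets \<open>G a\<close>
    change without affecting the candidates for \<open>a\<close>.\<close>
  have no0: "\<not> is_option s x 0" "\<not> is_option s x x" for x
    by (simp_all add: is_option_def assms)
  show ?thesis
    unfolding best_row_def
  proof (rule runs_upto_loop[where m = 0 and N = "s ''g'' 0 + 1" and n = 120 and
        I = "\<lambda>i s'. best_below s i (s' ''next'') (s' ''G'') a \<and>
    (\<forall>c. c \<noteq> a \<longrightarrow> s' ''next'' c = s ''next'' c \<and> s' ''G'' c = s ''G'' c)"], goal_cases)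
    case (5 i s')
    note fr = 5(5)[of "''a''"] 5(5)[of "''job''"] 5(5)[of "''V''"] 5(5)[of "''PA''"]
      5(5)[of "''PB''"] 5(5)[of "''g''"]
    have opt: "is_option s a i \<longleftrightarrow>
      s ''job'' i = s ''job'' a + 1 \<and> 0 < s ''V'' (2 * i + 1)"
      using 5(4) by (simp add: is_option_def)
    have cost: "step_cost s' a i = step_cost s a i"
      using fr by (simp add: step_cost_def)
    have eff: "effect best_choice s' =
      (if is_option s a i \<and> (s' ''next'' a = 0 \<or> step_cost s a i + s' ''G'' i < s' ''G'' a)
       then s'(''G'' := (s' ''G'')(a := step_cost s a i + s' ''G'' i),
         ''next'' := (s' ''next'')(a := i))
       else s')"
      using effect_best_choice[of s' a i] 5(2) fr assms(2) unfolding opt cost by simp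
    have Ga: "s' ''next'' a = 0 \<longleftrightarrow> (\<nexists>b. b < i \<and> is_option s a b)"
    proof (cases "\<exists>b<i. is_option s a b")
      case True
      then have "is_option s a (s' ''next'' a)" using 5(1) by (simp add: best_below_def)
      then show ?thesis using True no0(1)[of a] by (cases "s' ''next'' a = 0") auto
    qed (use 5(1) in \<open>auto simp: best_below_def\<close>)
    show ?case
    proof (rule runs_straight, goal_cases)
      case 2
      show ?case
      proof (cases "is_option s a i")
        case False
        then have "best_below s (Suc i) nxt G a = best_below s i nxt G a" for nxt G
          unfolding best_below_def using False by (auto simp: less_Suc_eq)
        then show ?thesis using False 5(1,2) unfolding eff by simp
      next
        case True
        then have "i \<noteq> a" using no0 by metis
        show ?thesis
        proof (cases "s' ''next'' a = 0 \<or> step_cost s a i + s' ''G'' i < s' ''G'' a")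
          case better: True
          let ?next = "(s' ''next'')(a := i)"
          let ?G = "(s' ''G'')(a := step_cost s a i + s' ''G'' i)"
          have "?G a \<le> step_cost s a b + ?G b" if "b < Suc i" "is_option s a b" for b
          proof (cases "b = i")
            case False
            then have "b < i" "b \<noteq> a" "s' ''next'' a \<noteq> 0"
              using that no0 Ga by auto
            then have "s' ''G'' a \<le> step_cost s a b + s' ''G'' b"
              using 5(1) that(2) by (auto simp: best_below_def split: if_splits)
            then show ?thesis
              using better \<open>b \<noteq> a\<close> \<open>s' ''next'' a \<noteq> 0\<close> by simp
          qed (use \<open>i \<noteq> a\<close> in simp)
          then have "best_below s (Suc i) ?next ?G a"
            using True \<open>i \<noteq> a\<close> unfolding best_below_def by auto
          then show ?thesis using True better 5(1,2) unfolding eff by auto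
        next
          case False
          have "best_below s (Suc i) (s' ''next'') (s' ''G'') a"
            using True False 5(1) Ga unfolding best_below_def
            by (auto simp: less_Suc_eq split: if_splits)
          then show ?thesis using False 5(1,2) unfolding eff by auto
        qed
      qed
    qed (simp_all add: straight_best_choice)
  next
    case 3
    show ?case by (simp add: best_below_def assms)
  next
    case (4 i s')
    show ?case using 4(3)[of "''g''"] by (simp add: straight_best_choice)
  next
    case (6 s')
    show ?case using 6(1) by simp
  next
    case 7
    show ?case using assms by simp
  qed (simp_all add: assms)
qed
text \<open>By \<open>mono\<close> the positions are in topological order. Rows are treated from the
  last one backwards, so each row reads only final values of \<open>G\<close>.\<close>

lemma best:
  assumes "1 \<le> s ''g'' 0" "s ''g'' 0 \<le> W" "s ''job'' 0 = 0"
    "s ''next'' = (\<lambda>_. 0)" "s ''G'' = (\<lambda>_. 0)"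
    and mono: "\<And>a b. a < s ''g'' 0 \<Longrightarrow> is_option s a b \<Longrightarrow> a < b"
  shows "runs best (900 * (W * W)) (\<lambda>s'. s' ''G'' (s ''g'' 0) = 0 \<and>
    (\<forall>a<s ''g'' 0. best_below s (s ''g'' 0 + 1) (s' ''next'') (s' ''G'') a)) s"
proof -
  have WW: "97 \<le> 100 * (W * W)"
    using assms mult_le_mono[of 1 W 1 W] by linarith
  define N where "N = s ''g'' 0"
  show ?thesis
    unfolding best_def block.simps
  proof (rule runs_Seq_straight, goal_cases)
    case 3
    show ?case
    proof (rule runs_upto_loop[where m = 0 and N = N and n = "340 * W" and
        I = "\<lambda>i s'. (\<forall>a<N. N - i \<le> a \<longrightarrow>
            best_below s (N + 1) (s' ''next'') (s' ''G'') a) \<and>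
          (\<forall>a. a < N - i \<or> a = N \<longrightarrow> s' ''next'' a = 0 \<and> s' ''G'' a = 0)"], goal_cases)
      case (5 i s')
      \<comment> \<open>Loops only count upwards, hence the reflected index.\<close>
      define a where "a = N - 1 - i"
      show ?case
      proof (rule runs_Seq_straight, goal_cases)
        case 3
        show ?case
        proof (rule runs_Seq_straight, goal_cases)
          case 3
          define t where "t = effect (assign ''b'' (Const 0))
              (effect (assign ''a'' (Sub (Sub (var ''g'') (Const 1)) (var ''i''))) s')"
          have s: "t ''a'' 0 = a" "t ''b'' 0 = 0" "t ''i'' 0 = i" "t ''g'' = s ''g''"
              "t ''job'' = s ''job''" "t ''V'' = s ''V''" "t ''PA'' = s ''PA''"
              "t ''PB'' = s ''PB''" "t ''next'' = s' ''next''" "t ''G'' = s' ''G''"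
            using 5(2) 5(5)[of "''g''"] 5(5)[of "''job''"] 5(5)[of "''V''"] 5(5)[of "''PA''"]
              5(5)[of "''PB''"] by (auto simp: t_def a_def N_def)
          have opt: "is_option t = is_option s" "step_cost t = step_cost s"
            using s by (auto simp: is_option_def step_cost_def fun_eq_iff)
          have below: "best_below t = best_below s"
            by (intro ext) (simp only: best_below_def opt)
          have a: "a < N - i" "N - Suc i = a" "a < N" "a \<noteq> N" using 5(4) by (auto simp: a_def)
          have row: "runs best_row (300 * W) (\<lambda>s'. best_below s (N + 1) (s' ''next'') (s' ''G'') a \<and>
    (\<forall>c. c \<noteq> a \<longrightarrow> s' ''next'' c = t ''next'' c \<and> s' ''G'' c = t ''G'' c)) t"
            using best_row[of t a W] s assms(1-3) 5(1) a(1) unfolding below s N_def by simp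
          show ?case
            unfolding t_def[symmetric]
          proof (rule runs_mono[OF row], goal_cases)
            case (2 t')
            \<comment> \<open>The row changes entries of \<open>a\<close> only, and arcs from a
              later vertex lead further on, so the equations established before survive.\<close>
            have "best_below s (N + 1) (t' ''next'') (t' ''G'') c" if "a \<le> c" "c < N" for c
            proof (cases "c = a")
              case False
              then have "best_below s (N + 1) (s' ''next'') (s' ''G'') c"
                using 5(1) that a by auto
              moreover have "t' ''G'' x = s' ''G'' x" if "x = c \<or> is_option s c x" for x
                using 2(1) s False mono[of c x] that \<open>a \<le> c\<close> \<open>c < N\<close> by (auto simp: N_def)
              moreover have "t' ''next'' c = s' ''next'' c" using 2(1) s False by auto
              ultimately show ?thesis unfolding best_below_def by (auto split: if_splits)
            qed (use 2(1) in simp)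
            moreover have "t' ''i'' 0 = i" using 2(2)[of "''i''"] s(3) by simp
            moreover have "t' ''next'' c = 0 \<and> t' ''G'' c = 0" if "c < a \<or> c = N" for c
              using 2(1) 5(1) a that s(9,10) by auto
            ultimately show ?case using a(2) by simp
          qed (use assms(1,2) in simp)
        qed (use assms(1,2) in simp_all)
      qed (use assms(1,2) in simp_all)
    next
      case 7
      have "(N - 0) * (340 * W + esize (var ''g'') + 12) +
        esize (var ''g'') + 4 \<le> 800 * (W * W)"
        by (rule quadratic_time[where K = 360]) (use assms in \<open>auto simp: N_def\<close>)
      also have "\<dots> \<le> 900 * (W * W) - Suc (length_bound (assign ''i'' (Const 0)))"
        using WW by simp
      finally show ?case .
    next
      case 3
      show ?case by (simp add: assms)
    next
      case (4 i s')
      show ?case using 4(3)[of "''g''"] by (simp add: N_def)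
    next
      case (6 s')
      show ?case using 6(1) by (simp add: N_def)
    qed simp_all
  qed (use WW in simp_all)
qed

section \<open>Writing the schedule\<close>

definition trace :: prog where
  "trace = block
    [assign ''h'' (Const 0),
     upto_loop ''h'' (Cell ''input'' (Const 2))
       (Store ''C'' (Add (var ''h'') (Const 1)) (Cell ''next'' (Cell ''C'' (var ''h''))))]"

text \<open>\<open>C (Suc h)\<close> is the position with which job \<open>h\<close> moves to the
  second machine, \<open>C 0\<close> the artificial start. The recursion can be stated on the final
  bank because each cell is written once, after the cell it depends on.\<close>

lemma trace:
  assumes "s ''C'' 0 = 0" "s ''input'' 2 \<le> W" "1 \<le> W"
  shows "runs trace (100 * (W * W)) (\<lambda>s'. s' ''C'' 0 = 0 \<and>
    (\<forall>h<s ''input'' 2. s' ''C'' (Suc h) = s ''next'' (s' ''C'' h))) s"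
proof -
  \<comment> \<open>\<open>W * W\<close> is hidden behind a variable so that the budget goals become
    linear.\<close>
  obtain Z where WW: "W * W = Z" "W \<le> Z"
    using assms(3) by simp
  show ?thesis
    unfolding trace_def block.simps
  proof (rule runs_Seq_straight, goal_cases)
    case 3
    show ?case
    proof (rule runs_upto_loop[where m = 0 and N = "s ''input'' 2" and n = 20 and
        I = "\<lambda>i s'. s' ''C'' 0 = 0 \<and> (\<forall>h<i. s' ''C'' (Suc h) = s ''next'' (s' ''C'' h))"], goal_cases)
      case (5 i s')
      then show ?case
        using 5(5)[of "''next''"] by (intro runs_straight) (auto simp: less_Suc_eq)
    next
      case 7
      have "(s ''input'' 2 - 0) * (20 + esize (Cell ''input'' (Const 2)) + 12) +
        esize (Cell ''input'' (Const 2)) + 4 \<le> 36 * W + 10" using assms by simp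
      also have "\<dots> \<le> 100 * (W * W) - Suc (length_bound (assign ''h'' (Const 0)))"
        using WW assms(3) by simp
      finally show ?case .
    qed (use assms in auto)
  qed (use WW assms(3) in auto)
qed

text \<open>The operations fill the output cells 1 to \<open>g - 1\<close>; the four words of
  position \<open>h\<close> follow from \<open>g + 4 * h\<close> on.\<close>

definition time_index :: "nat \<Rightarrow> expr" where
  "time_index r = Add (Add (var ''g'') (Mul (Const 4) (var ''h''))) (Const r)"

text \<open>The inner truncated difference is positive exactly for operations before the cut of
  their job; the outer one turns this into machine 0, and into machine 1 otherwise.\<close>

definition write_modes :: prog where
  "write_modes = upto_loop ''i'' (var ''g'')
     (Store ''output'' (var ''i'')
       (Sub (Const 1) (Sub (Cell ''C'' (Cell ''job'' (var ''i''))) (var ''i''))))"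

definition write_step :: prog where
  "write_step = block
     [Store ''output'' (time_index 0)
        (Sub (var ''G'') (Cell ''G'' (Cell ''C'' (var ''h'')))),
      Store ''output'' (time_index 1) (var ''V''),
      Store ''output'' (time_index 2)
        (Sub (var ''G'') (Cell ''G'' (Cell ''C'' (Add (var ''h'') (Const 1))))),
      Store ''output'' (time_index 3) (var ''V'')]"

definition write_times :: prog where
  "write_times = upto_loop ''h'' (Cell ''input'' (Const 2)) write_step"

definition write_output :: prog where
  "write_output = block
    [assign ''output'' (Add (Sub (var ''g'') (Const 1)) (Mul (Const 4) (Cell ''input'' (Const 2)))),
     assign ''i'' (Const 1),
     write_modes,
     assign ''h'' (Const 0),
     write_times]"

lemma writes_write [simp]:
  "writes write_modes = {''i'', ''output''}" "writes write_times = {''h'', ''output''}"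
  by (auto simp: write_modes_def write_times_def write_step_def)

lemma write_modes:
  assumes "s ''i'' 0 = 1" "1 \<le> s ''g'' 0" "s ''g'' 0 \<le> W"
  shows "runs write_modes (100 * W) (\<lambda>s'. s' ''output'' 0 = s ''output'' 0 \<and>
    (\<forall>i\<in>{1..<s ''g'' 0}. s' ''output'' i = 1 - (s ''C'' (s ''job'' i) - i))) s"
  unfolding write_modes_def
proof (rule runs_upto_loop[where m = 1 and N = "s ''g'' 0" and n = 20 and
      I = "\<lambda>i s'. s' ''output'' 0 = s ''output'' 0 \<and>
        (\<forall>j\<in>{1..<i}. s' ''output'' j = 1 - (s ''C'' (s ''job'' j) - j))"], goal_cases)
  case (5 i s')
  have fr: "s' ''C'' = s ''C''" "s' ''job'' = s ''job''"
    using 5(5)[of "''C''"] 5(5)[of "''job''"] by simp_all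
  show ?case
  proof (rule runs_straight, goal_cases)
    case 2
    show ?case using 5(1,2,3) fr by (auto simp: less_Suc_eq)
  qed simp_all
next
  case (4 i s')
  show ?case using 4(3)[of "''g''"] by simp
next
  case (6 s')
  show ?case using 6(1) by simp
qed (use assms in simp_all)

text \<open>Numerator and denominator alternate, first machine before second. The start on the
  second machine is taken from the next vertex of the path, hence the shift by
  \<open>r div 2\<close>.\<close>

definition time_entry :: "store \<Rightarrow> nat \<Rightarrow> nat \<Rightarrow> nat" where
  "time_entry s h r = (if even r then s ''G'' 0 - s ''G'' (s ''C'' (h + r div 2)) else s ''V'' 0)"

lemma effect_write_step:
  assumes "s ''g'' 0 = g" "s ''h'' 0 = h"
  shows "effect write_step s = s(''output'' := (s ''output'')
    (g + 4 * h := time_entry s h 0, g + 4 * h + 1 := time_entry s h 1,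
     g + 4 * h + 2 := time_entry s h 2, g + 4 * h + 3 := time_entry s h 3))"
  using assms by (simp add: write_step_def time_index_def time_entry_def)

lemma write_times:
  assumes "s ''h'' 0 = 0" "s ''input'' 2 \<le> W" "1 \<le> W" "1 \<le> s ''g'' 0"
  shows "runs write_times (200 * W) (\<lambda>s'.
    (\<forall>i<s ''g'' 0. s' ''output'' i = s ''output'' i) \<and>
    (\<forall>h<s ''input'' 2. \<forall>r<4. s' ''output'' (s ''g'' 0 + 4 * h + r) = time_entry s h r)) s"
  unfolding write_times_def
proof (rule runs_upto_loop[where m = 0 and N = "s ''input'' 2" and n = 160 and
      I = "\<lambda>i s'. (\<forall>i<s ''g'' 0. s' ''output'' i = s ''output'' i) \<and>
    (\<forall>h<i. \<forall>r<4. s' ''output'' (s ''g'' 0 + 4 * h + r) = time_entry s h r)"], goal_cases)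
  case (5 i s')
  define g where "g = s ''g'' 0"
  have fr: "s' ''G'' = s ''G''" "s' ''C'' = s ''C''" "s' ''V'' = s ''V''" "s' ''g'' 0 = g"
    using 5(5)[of "''G''"] 5(5)[of "''C''"] 5(5)[of "''V''"] 5(5)[of "''g''"]
    by (simp_all add: g_def write_step_def)
  define U where "U = (s' ''output'')(g + 4 * i := time_entry s i 0, g + 4 * i + 1 := time_entry s i 1,
    g + 4 * i + 2 := time_entry s i 2, g + 4 * i + 3 := time_entry s i 3)"
  have "U j = s ''output'' j" if "j < g" for j
    using 5(1) that by (simp add: U_def g_def)
  moreover have "U (g + 4 * h + r) = time_entry s h r" if "h < Suc i" "r < 4" for h r
  proof (cases "h = i")
    case True
    have "r = 0 \<or> r = 1 \<or> r = 2 \<or> r = 3" using that by auto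
    then show ?thesis using True by (auto simp: U_def)
  next
    case False
    then have "h < i" "g + 4 * h + r < g + 4 * i" using that by auto
    then show ?thesis using 5(1) that by (simp add: U_def g_def)
  qed
  ultimately have U: "(\<forall>j<g. U j = s ''output'' j) \<and>
    (\<forall>h<Suc i. \<forall>r<4. U (g + 4 * h + r) = time_entry s h r)" by blast
  have "time_entry s' = time_entry s" by (intro ext) (simp only: time_entry_def fr)
  then have eff: "effect write_step s' = s'(''output'' := U)"
    using effect_write_step[of s' g i] 5(2) fr(4) unfolding U_def by simp
  show ?case
  proof (rule runs_straight, goal_cases)
    case 2
    show ?case using U 5(2) unfolding eff g_def[symmetric] by simp
  qed (simp_all add: write_step_def time_index_def)
next
  case (4 i s')
  show ?case using 4(3)[of "''input''"] by (simp add: write_step_def)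
next
  case (6 s')
  show ?case using 6(1) by simp
qed (use assms in simp_all)

lemma write_output:
  assumes "1 \<le> s ''g'' 0" "s ''g'' 0 \<le> W" "s ''input'' 2 \<le> W"
  shows "runs write_output (500 * (W * W)) (\<lambda>s'.
    s' ''output'' 0 = s ''g'' 0 - 1 + 4 * s ''input'' 2 \<and>
    (\<forall>i\<in>{1..<s ''g'' 0}. s' ''output'' i = 1 - (s ''C'' (s ''job'' i) - i)) \<and>
    (\<forall>h<s ''input'' 2. \<forall>r<4. s' ''output'' (s ''g'' 0 + 4 * h + r) = time_entry s h r)) s"
proof -
  have W: "1 \<le> W" using assms by simp
  obtain Z where WW: "W * W = Z" "W \<le> Z"
    using W by simp
  show ?thesis
    unfolding write_output_def block.simps
  proof (rule runs_Seq_straight, goal_cases)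
    case 3
    show ?case
    proof (rule runs_Seq_straight, goal_cases)
      case 3
      define t where "t = effect (assign ''i'' (Const 1)) (effect (assign ''output''
        (Add (Sub (var ''g'') (Const 1)) (Mul (Const 4) (Cell ''input'' (Const 2))))) s)"
      have t: "t ''i'' 0 = 1" "t ''g'' = s ''g''" "t ''C'' = s ''C''" "t ''job'' = s ''job''"
        "t ''input'' = s ''input''" "t ''V'' = s ''V''" "t ''G'' = s ''G''"
        "t ''output'' 0 = s ''g'' 0 - 1 + 4 * s ''input'' 2"
        by (simp_all add: t_def)
      show ?case
        unfolding t_def[symmetric]
      proof (rule runs_Seq[OF write_modes[where W = W]], goal_cases)
        case (4 u)
        have u: "u ''g'' = s ''g''" "u ''C'' = s ''C''" "u ''input'' = s ''input''"
          "u ''V'' = s ''V''" "u ''G'' = s ''G''"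
          using 4(2) t by simp_all
        show ?case
        proof (rule runs_Seq_straight, goal_cases)
          case 3
          define v where "v = effect (assign ''h'' (Const 0)) u"
          have v: "v ''g'' = s ''g''" "v ''C'' = s ''C''" "v ''input'' = s ''input''"
            "v ''V'' = s ''V''" "v ''G'' = s ''G''" "v ''h'' 0 = 0" "v ''output'' = u ''output''"
            using u by (simp_all add: v_def)
          then have e: "time_entry v = time_entry s" by (intro ext) (simp only: time_entry_def)
          have "runs write_times (200 * W) (\<lambda>s'.
            (\<forall>i<s ''g'' 0. s' ''output'' i = u ''output'' i) \<and>
            (\<forall>h<s ''input'' 2. \<forall>r<4. s' ''output'' (s ''g'' 0 + 4 * h + r) = time_entry s h r)) v"
            using write_times[of v W] v e assms W by simp
          then show ?case
            unfolding v_def[symmetric]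
          proof (rule runs_mono, goal_cases)
            case 1
            then show ?case using WW W by simp
          next
            case (2 w)
            then show ?case using 4(1) t assms(1) by auto
          qed
        qed (use WW W in auto)
      qed (use t assms WW W in auto)
    qed (use WW W in auto)
  qed (use WW W in auto)
qed

section \<open>Reading the instance\<close>

definition op_num :: "operation \<Rightarrow> nat \<Rightarrow> nat" where
  "op_num x k = (if k \<in> machine_set x then nat (fst (quotient_of (ptime x k))) else 0)"

definition op_den :: "operation \<Rightarrow> nat \<Rightarrow> nat" where
  "op_den x k = (if k \<in> machine_set x then nat (snd (quotient_of (ptime x k))) else 1)"

definition readable :: "store \<Rightarrow> nat \<Rightarrow> nat list \<Rightarrow> bool" where
  "readable s p ws \<longleftrightarrow> (\<forall>r<length ws. s ''input'' (p + r) = ws ! r)"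

lemma readable_append:
  "readable s p (xs @ ys) \<longleftrightarrow> readable s p xs \<and> readable s (p + length xs) ys"
proof
  assume *: "readable s p (xs @ ys)"
  have "s ''input'' (p + length xs + r) = ys ! r" if "r < length ys" for r
    using *[unfolded readable_def, rule_format, of "length xs + r"] that
    by (simp add: add.assoc nth_append)
  then show "readable s p xs \<and> readable s (p + length xs) ys"
    using * by (auto simp: readable_def nth_append)
next
  assume *: "readable s p xs \<and> readable s (p + length xs) ys"
  have "s ''input'' (p + r) = (xs @ ys) ! r" if "r < length (xs @ ys)" for r
    using * that unfolding readable_def nth_append
    by (cases "r < length xs") (auto dest: spec[of _ "r - length xs"])
  then show "readable s p (xs @ ys)" by (simp add: readable_def)
qed

lemma readable_concat:
  assumes "readable s p (concat (map f xs))" "i < length xs"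
  shows "readable s (p + length (concat (map f (take i xs)))) (f (xs ! i))"
proof -
  have "concat (map f xs) =
      concat (map f (take i xs)) @ f (xs ! i) @ concat (map f (drop (Suc i) xs))"
    using id_take_nth_drop[OF assms(2)] by (metis concat.simps(2) concat_append list.simps(9) map_append)
  then show ?thesis using assms(1) by (simp add: readable_append)
qed

definition word :: "nat \<Rightarrow> expr" where
  "word r = Cell ''input'' (Add (var ''pos'') (Const r))"

definition store_times :: "expr \<Rightarrow> expr \<Rightarrow> expr \<Rightarrow> expr \<Rightarrow> prog" where
  "store_times e1 e2 e3 e4 = block
    [Store ''num'' (double (var ''g'')) e1,
     Store ''num'' (Add (double (var ''g'')) (Const 1)) e3,
     Store ''den'' (double (var ''g'')) e2,
     Store ''den'' (Add (double (var ''g'')) (Const 1)) e4]"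

text \<open>A fixed operation has tag 0 and four words, a shiftable one tag 1 and six. With two
  machines a shiftable operation always has the machine set {0, 1}, so only the fixed case branches
  on the machine index.\<close>

definition parse_operation :: prog where
  "parse_operation = block
    [Store ''job'' (var ''g'') (var ''h''),
     Cond (Less (word 0) (Const 1))
       (block
         [Cond (Less (word 1) (Const 1))
            (store_times (word 2) (word 3) (Const 0) (Const 1))
            (store_times (Const 0) (Const 1) (word 2) (word 3)),
          assign ''pos'' (Add (var ''pos'') (Const 4))])
       (block
         [store_times (word 2) (word 3) (word 4) (word 5),
          assign ''pos'' (Add (var ''pos'') (Const 6))])]"

lemma straight_parse_operation:
  "straight parse_operation" "length_bound parse_operation \<le> 300"
  by (simp_all add: parse_operation_def store_times_def word_def)

lemma writes_parse_operation [simp]: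
  "writes parse_operation = {''job'', ''num'', ''den'', ''pos''}"
  by (auto simp: parse_operation_def store_times_def)

lemma effect_parse_operation:
  assumes "s ''g'' 0 = g" "s ''pos'' 0 = p" "readable s p (encode_operation x)"
    "machine_set x \<subseteq> {..<2}"
  shows "effect parse_operation s = s
    (''job'' := (s ''job'')(g := s ''h'' 0),
     ''num'' := (s ''num'')(2 * g := op_num x 0, 2 * g + 1 := op_num x 1),
     ''den'' := (s ''den'')(2 * g := op_den x 0, 2 * g + 1 := op_den x 1),
     ''pos'' := (s ''pos'')(0 := p + length (encode_operation x)))"
proof -
  have r: "s ''input'' (p + r) = encode_operation x ! r" if "r < length (encode_operation x)" for r
    using assms(3) that by (simp add: readable_def)
  show ?thesis
  proof (cases x)
    case (Fixed k q)
    have w: "s ''input'' p = 0" "s ''input'' (p + 1) = k"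
      "s ''input'' (p + 2) = nat (fst (quotient_of q))"
      "s ''input'' (p + 3) = nat (snd (quotient_of q))"
      using r[of 0] r[of 1] r[of 2] r[of 3] unfolding Fixed
      by (simp_all add: encode_rat_def)
    have "k = 0 \<or> k = 1" using assms(4) Fixed by auto
    moreover have l: "length (encode_operation x) = 4" using Fixed by (simp add: encode_rat_def)
    ultimately show ?thesis
      unfolding l
      using w assms(1,2) Fixed
      by (elim disjE) (simp_all add: parse_operation_def store_times_def word_def op_num_def
          op_den_def encode_rat_def)
  next
    case (Shiftable k q q')
    have w: "s ''input'' p = 1" "s ''input'' (p + 2) = nat (fst (quotient_of q))"
      "s ''input'' (p + 3) = nat (snd (quotient_of q))"
      "s ''input'' (p + 4) = nat (fst (quotient_of q'))"
      "s ''input'' (p + 5) = nat (snd (quotient_of q'))"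
      using r[of 0] r[of 2] r[of 3] r[of 4] r[of 5] unfolding Shiftable
      by (simp_all add: encode_rat_def)
    have "k = 0" using assms(4) Shiftable by auto
    moreover have l: "length (encode_operation x) = 6" using Shiftable by (simp add: encode_rat_def)
    ultimately show ?thesis
      unfolding l
      using w assms(1,2) Shiftable
      by (simp add: parse_operation_def store_times_def word_def op_num_def
          op_den_def encode_rat_def)
  qed
qed

section \<open>Consecutive numbering of the operations of all jobs\<close>

definition offset :: "operation list list \<Rightarrow> nat \<Rightarrow> nat" where
  "offset js h = length (concat (take h js))"

lemma offset_0 [simp]: "offset js 0 = 0"
  by (simp add: offset_def)

lemma offset_Suc: "h < length js \<Longrightarrow> offset js (Suc h) = offset js h + length (js ! h)"
  by (simp add: offset_def take_Suc_conv_app_nth)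

lemma offset_mono:
  assumes "h \<le> h'"
  shows "offset js h \<le> offset js h'"
proof -
  have "take h' js = take h js @ take (h' - h) (drop h js)"
    using assms by (metis le_add_diff_inverse take_add)
  then show ?thesis by (simp add: offset_def)
qed

lemma offset_less:
  "h < h' \<Longrightarrow> h' \<le> length js \<Longrightarrow> i < length (js ! h) \<Longrightarrow> offset js h + i < offset js h'"
  using offset_mono[of "Suc h" h' js] offset_Suc[of h js] by simp

definition entry :: "store \<Rightarrow> nat \<Rightarrow> nat \<Rightarrow> operation \<Rightarrow> bool" where
  "entry s g j x \<longleftrightarrow> s ''job'' g = j \<and>
     s ''num'' (2 * g) = op_num x 0 \<and> s ''num'' (2 * g + 1) = op_num x 1 \<and>
     s ''den'' (2 * g) = op_den x 0 \<and> s ''den'' (2 * g + 1) = op_den x 1"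

text \<open>The operations before \<open>(h, i)\<close> in lexicographic order have been read;
  \<open>(h, 0)\<close> thus means that the first \<open>h\<close> jobs are complete. Job numbers in
  the store begin with 1, as 0 belongs to the artificial start.\<close>

definition parsed :: "operation list list \<Rightarrow> store \<Rightarrow> nat \<Rightarrow> nat \<Rightarrow> bool" where
  "parsed js s h i \<longleftrightarrow> s ''num'' 0 = 1 \<and> s ''num'' 1 = 0 \<and> s ''job'' 0 = 0 \<and>
     (\<forall>h' i'. h' < h \<and> i' < length (js ! h') \<or> h' = h \<and> i' < i \<longrightarrow>
        entry s (1 + offset js h' + i') (h' + 1) (js ! h' ! i'))"

lemma parsed_Suc_job: "parsed js s h (length (js ! h)) \<Longrightarrow> parsed js s (Suc h) 0"
  by (auto simp: parsed_def less_Suc_eq)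

lemma parsed_Suc:
  assumes "parsed js s h i" "h < length js"
    "t ''job'' = (s ''job'')(1 + offset js h + i := h + 1)"
    "t ''num'' = (s ''num'')(2 * (1 + offset js h + i) := op_num (js ! h ! i) 0,
       2 * (1 + offset js h + i) + 1 := op_num (js ! h ! i) 1)"
    "t ''den'' = (s ''den'')(2 * (1 + offset js h + i) := op_den (js ! h ! i) 0,
       2 * (1 + offset js h + i) + 1 := op_den (js ! h ! i) 1)"
  shows "parsed js t h (Suc i)"
proof -
  define g where "g = 1 + offset js h + i"
  note t = assms(3-5)[folded g_def]
  have old: "entry t g' j x" if "entry s g' j x" "g' < g" for g' j x
  proof -
    have "2 * g' \<noteq> 2 * g" "2 * g' \<noteq> 2 * g + 1" "2 * g' + 1 \<noteq> 2 * g" "2 * g' + 1 \<noteq> 2 * g + 1"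
      using that(2) by presburger+
    then show ?thesis using that unfolding entry_def t by simp
  qed
  have new: "entry t g (h + 1) (js ! h ! i)"
    unfolding entry_def t by simp
  have "entry t (1 + offset js h' + i') (h' + 1) (js ! h' ! i')"
    if "h' < h \<and> i' < length (js ! h') \<or> h' = h \<and> i' < Suc i" for h' i'
  proof (cases "h' = h \<and> i' = i")
    case True
    then show ?thesis using new by (simp add: g_def)
  next
    case False
    then have *: "h' < h \<and> i' < length (js ! h') \<or> h' = h \<and> i' < i" using that by auto
    then have "1 + offset js h' + i' < g"
      using offset_less[of h' h js i'] assms(2) by (auto simp: g_def)
    then show ?thesis using assms(1) * old unfolding parsed_def by blast
  qed
  moreover have "t ''num'' 0 = 1 \<and> t ''num'' 1 = 0 \<and> t ''job'' 0 = 0"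
    using assms(1) unfolding parsed_def t by (simp add: g_def)
  ultimately show ?thesis unfolding parsed_def by blast
qed

definition parse_operations :: prog where
  "parse_operations = upto_loop ''g'' (var ''end'') parse_operation"

text \<open>The counter \<open>g\<close> runs on through all jobs, so the invariant recovers the
  index within the job as a difference.\<close>

lemma parse_operations:
  assumes "readable s p (concat (map encode_operation (js ! h)))" "s ''pos'' 0 = p"
    "s ''g'' 0 = 1 + offset js h" "s ''end'' 0 = 1 + offset js h + length (js ! h)"
    "s ''h'' 0 = h + 1" "h < length js" "parsed js s h 0"
    "\<And>x. x \<in> set (js ! h) \<Longrightarrow> machine_set x \<subseteq> {..<2}"
    "length (js ! h) < W"
  shows "runs parse_operations (400 * W) (\<lambda>t. parsed js t h (length (js ! h)) \<and>
    t ''pos'' 0 = p + length (concat (map encode_operation (js ! h))) \<and>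
    t ''g'' 0 = 1 + offset js h + length (js ! h)) s"
  unfolding parse_operations_def
proof (rule runs_upto_loop[where m = "1 + offset js h" and n = 300 and
      N = "1 + offset js h + length (js ! h)" and
      I = "\<lambda>m t. parsed js t h (m - (1 + offset js h)) \<and> t ''pos'' 0 =
        p + length (concat (map encode_operation (take (m - (1 + offset js h)) (js ! h))))"],
    goal_cases)
  case (5 m t)
  define i where "i = m - (1 + offset js h)"
  have m: "m = 1 + offset js h + i" "Suc m - (1 + offset js h) = Suc i" "i < length (js ! h)"
    using 5(3,4) by (simp_all add: i_def)
  have fr: "t ''h'' 0 = h + 1" "t ''input'' = s ''input''"
    using 5(5)[of "''h''"] 5(5)[of "''input''"] assms(5) by simp_all
  have pos: "t ''pos'' 0 = p + length (concat (map encode_operation (take i (js ! h))))"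
    and parsed: "parsed js t h i"
    using 5(1) by (simp_all add: i_def)
  have "readable t (t ''pos'' 0) (encode_operation (js ! h ! i))"
    using readable_concat[OF assms(1) m(3)] fr pos by (simp add: readable_def)
  then have eff: "effect parse_operation t = t
    (''job'' := (t ''job'')(m := h + 1),
     ''num'' := (t ''num'')(2 * m := op_num (js ! h ! i) 0, 2 * m + 1 := op_num (js ! h ! i) 1),
     ''den'' := (t ''den'')(2 * m := op_den (js ! h ! i) 0, 2 * m + 1 := op_den (js ! h ! i) 1),
     ''pos'' := (t ''pos'')(0 := t ''pos'' 0 + length (encode_operation (js ! h ! i))))"
    using effect_parse_operation[of t m "t ''pos'' 0" "js ! h ! i"] 5(2) fr(1) assms(8) m(3) by simp
  show ?case
  proof (rule runs_straight, goal_cases)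
    case 2
    have "parsed js ((effect parse_operation t)(''g'' := (effect parse_operation t ''g'')(0 := Suc m)))
        h (Suc i)"
      by (rule parsed_Suc[OF parsed assms(6)]) (simp_all add: eff m(1))
    then show ?case
      using 5(2) pos m(3) unfolding m(2) by (simp add: eff take_Suc_conv_app_nth)
  qed (simp_all add: straight_parse_operation)
next
  case (4 i t)
  show ?case using 4(3)[of "''end''"] assms(4) by simp
next
  case (6 t)
  then show ?case by simp
qed (use assms in simp_all)

definition parse_job :: prog where
  "parse_job = block
    [assign ''end'' (Add (var ''g'') (word 0)),
     assign ''pos'' (Add (var ''pos'') (Const 1)),
     parse_operations]"

text \<open>The jobs begin in cell 3, behind the word count, the number of machines and the number
  of jobs. The counter \<open>h\<close> leaves the loop as the number of jobs plus one, which
  becomes the job number of the artificial end.\<close>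

definition parse :: prog where
  "parse = block
    [Store ''num'' (Const 0) (Const 1),
     assign ''pos'' (Const 3),
     assign ''g'' (Const 1),
     assign ''h'' (Const 1),
     upto_loop ''h'' (Add (Cell ''input'' (Const 2)) (Const 1)) parse_job,
     Store ''job'' (var ''g'') (var ''h'')]"

lemma writes_parse [simp]:
  "writes parse_operations = {''job'', ''num'', ''den'', ''pos'', ''g''}"
  "writes parse_job = {''job'', ''num'', ''den'', ''pos'', ''g'', ''end''}"
  by (auto simp: parse_operations_def parse_job_def)

lemma parsed_cong:
  "s ''num'' = t ''num'' \<Longrightarrow> s ''den'' = t ''den'' \<Longrightarrow> s ''job'' = t ''job'' \<Longrightarrow>
    parsed js s h i = parsed js t h i"
  by (simp add: parsed_def entry_def)

lemma parse_job:
  assumes "readable s p (encode_job (js ! h))" "s ''pos'' 0 = p"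
    "s ''g'' 0 = 1 + offset js h" "s ''h'' 0 = h + 1" "h < length js" "parsed js s h 0"
    "\<And>x. x \<in> set (js ! h) \<Longrightarrow> machine_set x \<subseteq> {..<2}"
    "length (js ! h) < W"
  shows "runs parse_job (450 * W) (\<lambda>t. parsed js t (Suc h) 0 \<and>
    t ''pos'' 0 = p + length (encode_job (js ! h)) \<and> t ''g'' 0 = 1 + offset js (Suc h)) s"
proof -
  define t where "t = effect (assign ''pos'' (Add (var ''pos'') (Const 1)))
    (effect (assign ''end'' (Add (var ''g'') (word 0))) s)"
  have "readable s p [length (js ! h)]"
    and ops: "readable s (p + 1) (concat (map encode_operation (js ! h)))"
    using assms(1) readable_append[of s p "[length (js ! h)]" "concat (map encode_operation (js ! h))"]
    by (simp_all add: encode_job_def)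
  then have w: "s ''input'' p = length (js ! h)" by (simp add: readable_def)
  have t: "t ''pos'' 0 = p + 1" "t ''g'' 0 = 1 + offset js h" "t ''h'' 0 = h + 1"
    "t ''end'' 0 = 1 + offset js h + length (js ! h)" "t ''input'' = s ''input''"
    "t ''num'' = s ''num''" "t ''den'' = s ''den''" "t ''job'' = s ''job''"
    using assms(2-4) w by (simp_all add: t_def word_def)
  have "parsed js t h 0" using assms(6) parsed_cong[of t s] t by simp
  then have "runs parse_operations (400 * W) (\<lambda>t. parsed js t h (length (js ! h)) \<and>
      t ''pos'' 0 = p + 1 + length (concat (map encode_operation (js ! h))) \<and>
      t ''g'' 0 = 1 + offset js h + length (js ! h)) t"
    using ops assms(5,7,8) t by (intro parse_operations) (simp_all add: readable_def)
  then have run: "runs parse_operations (400 * W) (\<lambda>t. parsed js t (Suc h) 0 \<and>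
    t ''pos'' 0 = p + length (encode_job (js ! h)) \<and> t ''g'' 0 = 1 + offset js (Suc h)) t"
    by (rule runs_mono) (auto simp: parsed_Suc_job offset_Suc assms(5) encode_job_def)
  show ?thesis
    unfolding parse_job_def block.simps
  proof (rule runs_Seq_straight, goal_cases)
    case 3
    show ?case
    proof (rule runs_Seq_straight, goal_cases)
      case 3
      show ?case
        unfolding t_def[symmetric]
        by (rule runs_mono[OF run]) (use assms(8) in \<open>simp_all add: word_def\<close>)
    qed (use assms(8) in \<open>simp_all add: word_def\<close>)
  qed (use assms(8) in \<open>simp_all add: word_def\<close>)
qed

lemma parse:
  assumes "readable s 3 (concat (map encode_job js))" "s ''input'' 2 = length js"
    "s ''num'' 1 = 0" "s ''job'' 0 = 0"
    "\<And>ops x. ops \<in> set js \<Longrightarrow> x \<in> set ops \<Longrightarrow> machine_set x \<subseteq> {..<2}"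
    "offset js (length js) + length js < W"
  shows "runs parse (1100 * (W * W)) (\<lambda>t. parsed js t (length js) 0 \<and>
    t ''g'' 0 = 1 + offset js (length js) \<and> t ''job'' (t ''g'' 0) = length js + 1) s"
proof -
  obtain Z where Z: "W * W = Z" "1 \<le> Z"
    using assms(6) by simp
  define u where "u = effect (assign ''h'' (Const 1)) (effect (assign ''g'' (Const 1))
    (effect (assign ''pos'' (Const 3)) (effect (Store ''num'' (Const 0) (Const 1)) s)))"
  have u: "u ''pos'' 0 = 3" "u ''g'' 0 = 1" "u ''h'' 0 = 1" "u ''num'' 0 = 1" "u ''num'' 1 = 0"
    "u ''job'' 0 = 0" "u ''input'' = s ''input''"
    using assms(3,4) by (simp_all add: u_def)
  have loop: "runs (upto_loop ''h'' (Add (Cell ''input'' (Const 2)) (Const 1)) parse_job)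
    (1000 * (W * W)) (\<lambda>t. parsed js t (length js) 0 \<and>
      t ''g'' 0 = 1 + offset js (length js) \<and> t ''h'' 0 = length js + 1) u"
  proof (rule runs_upto_loop[where m = 1 and n = "450 * W" and N = "length js + 1" and
      I = "\<lambda>m t. parsed js t (m - 1) 0 \<and> t ''g'' 0 = 1 + offset js (m - 1) \<and>
        t ''pos'' 0 = 3 + length (concat (map encode_job (take (m - 1) js)))"], goal_cases)
    case (5 m t)
    define h where "h = m - 1"
    have m: "m = h + 1" "Suc m - 1 = Suc h" "h < length js" using 5(3,4) by (simp_all add: h_def)
    have I: "parsed js t h 0" "t ''g'' 0 = 1 + offset js h"
      "t ''pos'' 0 = 3 + length (concat (map encode_job (take h js)))"
      using 5(1) by (simp_all add: h_def)
    have "readable t (t ''pos'' 0) (encode_job (js ! h))"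
      using readable_concat[OF assms(1) m(3)] I(3) 5(5)[of "''input''"] u(7)
      by (simp add: readable_def)
    moreover have "length (js ! h) < W"
      using offset_mono[of "Suc h" "length js" js] offset_Suc[OF m(3)] m(3) assms(6) by simp
    ultimately have "runs parse_job (450 * W) (\<lambda>t'. parsed js t' (Suc h) 0 \<and>
      t' ''pos'' 0 = t ''pos'' 0 + length (encode_job (js ! h)) \<and> t' ''g'' 0 = 1 + offset js (Suc h)) t"
      using I m 5(2) assms(5)[OF nth_mem[OF m(3)]] by (intro parse_job) simp_all
    then show ?case
    proof (rule runs_mono, goal_cases)
      case (2 t')
      have "t' ''h'' 0 = m" using 2(2)[of "''h''"] 5(2) by simp
      moreover have "parsed js (t'(''h'' := (t' ''h'')(0 := Suc m))) (Suc h) 0"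
        using 2(1) parsed_cong[of "t'(''h'' := (t' ''h'')(0 := Suc m))" t'] by simp
      ultimately show ?case
        using 2(1) I(3) m(3) unfolding m(2) by (simp add: take_Suc_conv_app_nth)
    qed simp
  next
    case (4 i t)
    show ?case using 4(3)[of "''input''"] u(7) assms(2) by simp
  next
    case (6 t)
    then show ?case by simp
  next
    case 7
    show ?case by (rule quadratic_time[where K = 480]) (use assms(6) in simp_all)
  next
    case 3
    show ?case using u by (simp add: parsed_def)
  qed (use u in simp_all)
  show ?thesis
    unfolding parse_def block.simps
  proof (rule runs_Seq_straight, goal_cases)
    case 3
    show ?case
    proof (rule runs_Seq_straight, goal_cases)
      case 3
      show ?case
      proof (rule runs_Seq_straight, goal_cases)
        case 3
        show ?case
        proof (rule runs_Seq_straight, goal_cases)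
          case 3
          show ?case
            unfolding u_def[symmetric]
          proof (rule runs_Seq[OF loop], goal_cases)
            case (1 t)
            let ?t = "t(''job'' := (t ''job'')(1 + offset js (length js) := length js + 1))"
            have "entry ?t (1 + offset js h + i) j x"
              if "entry t (1 + offset js h + i) j x" "h < length js" "i < length (js ! h)" for h i j x
              using that offset_less[of h "length js" js i] by (simp add: entry_def)
            then have p: "parsed js ?t (length js) 0"
              using 1(1) by (simp add: parsed_def)
            show ?case
            proof (rule runs_straight, goal_cases)
              case 2
              show ?case using 1(1) p by simp
            qed (use Z in simp_all)
          qed (use Z in simp_all)
        qed (use Z in simp_all)
      qed (use Z in simp_all)
    qed (use Z in simp_all)
  qed (use Z in simp_all)
qed

section \<open>Assignment modes as cuts\<close>

definition op_time :: "operation \<Rightarrow> nat \<Rightarrow> rat" where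
  "op_time x k = (if k \<in> machine_set x then ptime x k else 0)"

lemma op_den_pos: "0 < op_den x k"
  by (simp add: op_den_def quotient_of_denom_pos')

text \<open>Times on admissible machines are positive, so the numerator is positive exactly if the
  machine can process the operation. The program's test for possible cuts rests on this.\<close>

lemma op_num_eq:
  assumes "k \<in> machine_set x \<Longrightarrow> 0 < ptime x k"
  shows "real (op_num x k) = real_of_rat (op_time x k) * real (op_den x k)"
    and "0 < op_num x k \<longleftrightarrow> k \<in> machine_set x"
proof -
  have *: "real (nat a) = real_of_rat q * real (nat b) \<and> 0 < a" if "quotient_of q = (a, b)" "0 < q" for q a b
  proof -
    have b: "0 < b" using that(1) by (rule quotient_of_denom_pos)
    have q: "q = of_int a / of_int b" using that(1) by (rule quotient_of_div)
    then have "0 < a" using that(2) b by (simp add: zero_less_divide_iff)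
    moreover have "real_of_rat q * real_of_int b = real_of_int a"
      using b by (simp add: q of_rat_divide)
    ultimately show ?thesis using b by simp
  qed
  obtain a b where ab: "quotient_of (ptime x k) = (a, b)" by fastforce
  show "real (op_num x k) = real_of_rat (op_time x k) * real (op_den x k)"
    "0 < op_num x k \<longleftrightarrow> k \<in> machine_set x"
    using assms *[OF ab] ab by (cases "k \<in> machine_set x"; simp add: op_num_def op_den_def op_time_def)+
qed

definition head_time :: "operation list \<Rightarrow> nat \<Rightarrow> rat" where
  "head_time ops l = (\<Sum>i<l. op_time (ops ! i) 0)"

definition tail_time :: "operation list \<Rightarrow> nat \<Rightarrow> rat" where
  "tail_time ops l = (\<Sum>i\<in>{l..<length ops}. op_time (ops ! i) 1)"

text \<open>A cut \<open>l\<close> of a job stands for the assignment mode that moves to the second machine with operation \<open>l\<close>.\<close>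

definition cut :: "operation list \<Rightarrow> nat \<Rightarrow> bool" where
  "cut ops l \<longleftrightarrow> l < length ops \<and> 1 \<in> machine_set (ops ! l)"

definition cut_mode :: "nat \<Rightarrow> nat \<Rightarrow> nat" where
  "cut_mode l i = (if i < l then 0 else 1)"

lemma machine_set_cases:
  assumes "fixb_job 2 ops" "i < length ops"
  shows "machine_set (ops ! i) = {0} \<or> machine_set (ops ! i) = {0, 1} \<or> machine_set (ops ! i) = {1}"
proof -
  have "machine_set (ops ! i) \<subseteq> {..<2}"
    using assms by (simp add: fixb_job_def)
  then show ?thesis by (cases "ops ! i") auto
qed

lemma unique_last_operation:
  assumes "fixb_job 2 ops"
  shows "\<exists>!i. i < length ops \<and> machine_set (ops ! i) = {1}"
proof -
  have "\<forall>k<2. \<exists>!i. i < length ops \<and> machine_set (ops ! i) = {k}"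
    using assms unfolding fixb_job_def by blast
  from this[rule_format, of 1] show ?thesis by simp
qed

lemma exists_cut:
  assumes "fixb_job 2 ops"
  shows "\<exists>l. cut ops l"
proof -
  obtain i where "i < length ops" "machine_set (ops ! i) = {1}"
    using unique_last_operation[OF assms] by blast
  then show ?thesis by (auto simp: cut_def)
qed

lemma fixb_job_sorted:
  assumes "fixb_job 2 ops" "i \<le> j" "j < length ops"
  shows "1 \<in> machine_set (ops ! i) \<Longrightarrow> 1 \<in> machine_set (ops ! j)"
    and "0 \<in> machine_set (ops ! j) \<Longrightarrow> 0 \<in> machine_set (ops ! i)"
proof -
  define A where "A = machine_set (ops ! i)"
  define B where "B = machine_set (ops ! j)"
  have "sorted (map (\<lambda>x. Min (machine_set x) + Max (machine_set x)) ops)"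
    using assms(1) by (simp add: fixb_job_def)
  from sorted_nth_mono[OF this assms(2)] assms(2,3) have le: "Min A + Max A \<le> Min B + Max B"
    by (simp add: A_def B_def)
  have "A = {0} \<or> A = {0, 1} \<or> A = {1}" "B = {0} \<or> B = {0, 1} \<or> B = {1}"
    using machine_set_cases[OF assms(1)] assms(2,3) by (simp_all add: A_def B_def)
  then have "(1 \<in> A \<longrightarrow> 1 \<in> B) \<and> (0 \<in> B \<longrightarrow> 0 \<in> A)"
    using le by (elim disjE) simp_all
  then show "1 \<in> machine_set (ops ! i) \<Longrightarrow> 1 \<in> machine_set (ops ! j)"
    "0 \<in> machine_set (ops ! j) \<Longrightarrow> 0 \<in> machine_set (ops ! i)"
    by (simp_all add: A_def B_def)
qed

lemma machine_after_cut:
  assumes "fixb_job 2 ops" "cut ops l" "l \<le> i" "i < length ops"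
  shows "1 \<in> machine_set (ops ! i)"
  using fixb_job_sorted(1)[OF assms(1,3,4)] assms(2) by (simp add: cut_def)

text \<open>If operation \<open>i\<close> could not run on the first machine, sortedness would
  exclude \<open>l\<close> from it as well. Both would have the machine set {1}, against its
  uniqueness.\<close>

lemma machine_before_cut:
  assumes "fixb_job 2 ops" "cut ops l" "i < l"
  shows "0 \<in> machine_set (ops ! i)"
proof (rule ccontr)
  assume *: "0 \<notin> machine_set (ops ! i)"
  have i: "i < length ops" and l: "l < length ops" using assms by (auto simp: cut_def)
  have "0 \<notin> machine_set (ops ! l)"
    using * fixb_job_sorted(2)[OF assms(1) less_imp_le[OF assms(3)] l] by blast
  then have "machine_set (ops ! i) = {1}" "machine_set (ops ! l) = {1}"
    using * machine_set_cases[OF assms(1) i] machine_set_cases[OF assms(1) l] by blast+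
  then show False using unique_last_operation[OF assms(1)] i l assms(3) by (metis less_irrefl)
qed

lemma assignment_mode_cut:
  assumes "fixb_job 2 ops" "cut ops l"
  shows "assignment_mode ops (cut_mode l)"
  using machine_after_cut[OF assms] machine_before_cut[OF assms]
  by (auto simp: assignment_mode_def cut_mode_def mono_on_def not_less)

lemma assignment_mode_cong:
  assumes "assignment_mode ops a" "\<And>i. i < length ops \<Longrightarrow> b i = a i"
  shows "assignment_mode ops b"
  using assms by (auto simp: assignment_mode_def mono_on_def)

text \<open>The cut is the first operation assigned to the second machine. It exists because the
  operation with machine set {1} leaves no choice, and monotonicity sends everything behind it to
  the same machine.\<close>

lemma cut_of_assignment_mode:
  assumes "fixb_job 2 ops" "assignment_mode ops a"
  shows "\<exists>l. cut ops l \<and> (\<forall>i<length ops. a i = cut_mode l i)"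
proof -
  have a: "a i \<in> machine_set (ops ! i)" if "i < length ops" for i
    using assms(2) that by (simp add: assignment_mode_def)
  then have a01: "a i = 0 \<or> a i = 1" if "i < length ops" for i
    using machine_set_cases[OF assms(1) that] that by fastforce
  obtain i where "i < length ops" "machine_set (ops ! i) = {1}"
    using unique_last_operation[OF assms(1)] by blast
  then have ex: "\<exists>i. i < length ops \<and> a i = 1" using a[of i] by auto
  define l where "l = (LEAST i. i < length ops \<and> a i = 1)"
  have l: "l < length ops" "a l = 1" using LeastI_ex[OF ex] by (simp_all add: l_def)
  have "a i = cut_mode l i" if "i < length ops" for i
  proof (cases "i < l")
    case True
    then show ?thesis using not_less_Least[of i] a01[OF that] that by (auto simp: l_def cut_mode_def)
  next
    case False
    then have "a l \<le> a i" using assms(2) l that mono_onD[of "{..<length ops}" a l i]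
      by (simp add: assignment_mode_def)
    then show ?thesis using False l a01[OF that] by (auto simp: cut_mode_def)
  qed
  then show ?thesis using l a[OF l(1)] by (auto simp: cut_def)
qed

lemma total_ptime_cut:
  assumes "fixb_job 2 ops" "cut ops l" "\<And>i. i < length ops \<Longrightarrow> a i = cut_mode l i"
  shows "total_ptime ops a 0 = head_time ops l" "total_ptime ops a 1 = tail_time ops l"
proof -
  have l: "l < length ops" using assms(2) by (simp add: cut_def)
  have "{i. i < length ops \<and> a i = 0} = {..<l}"
  proof (intro set_eqI)
    show "i \<in> {i. i < length ops \<and> a i = 0} \<longleftrightarrow> i \<in> {..<l}" for i
      using assms(3)[of i] l unfolding cut_mode_def by (cases "i < l") auto
  qed
  then have "total_ptime ops a 0 = (\<Sum>i\<in>{..<l}. ptime (ops ! i) 0)"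
    unfolding total_ptime_def by (simp only:)
  also have "\<dots> = head_time ops l"
    unfolding head_time_def
  proof (rule sum.cong[OF refl])
    show "ptime (ops ! i) 0 = op_time (ops ! i) 0" if "i \<in> {..<l}" for i
      using machine_before_cut[OF assms(1,2), of i] that by (simp add: op_time_def)
  qed
  finally show "total_ptime ops a 0 = head_time ops l" .
  have "{i. i < length ops \<and> a i = 1} = {l..<length ops}"
  proof (intro set_eqI)
    show "i \<in> {i. i < length ops \<and> a i = 1} \<longleftrightarrow> i \<in> {l..<length ops}" for i
      using assms(3)[of i] l unfolding cut_mode_def by (cases "i < l") auto
  qed
  then have "total_ptime ops a 1 = (\<Sum>i\<in>{l..<length ops}. ptime (ops ! i) 1)"
    unfolding total_ptime_def by (simp only:)
  also have "\<dots> = tail_time ops l"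
    unfolding tail_time_def
  proof (rule sum.cong[OF refl])
    show "ptime (ops ! i) 1 = op_time (ops ! i) 1" if "i \<in> {l..<length ops}" for i
      using machine_after_cut[OF assms(1,2), of i] that by (simp add: op_time_def)
  qed
  finally show "total_ptime ops a 1 = tail_time ops l" .
qed

section \<open>Recovering jobs and operations from their numbers\<close>

lemma offset_decompose:
  assumes "1 \<le> g" "g \<le> offset js h" "h \<le> length js"
  shows "\<exists>h'<h. \<exists>i<length (js ! h'). g = 1 + offset js h' + i"
  using assms
proof (induction h)
  case (Suc h)
  show ?case
  proof (cases "g \<le> offset js h")
    case True
    then obtain h' i where "h' < h" "i < length (js ! h')" "g = 1 + offset js h' + i"
      using Suc by auto
    then show ?thesis using less_SucI by blast
  next
    case False
    then have "g = 1 + offset js h + (g - 1 - offset js h)" "g - 1 - offset js h < length (js ! h)"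
      using Suc.prems offset_Suc[of h js] by auto
    then show ?thesis by blast
  qed
qed simp

lemma entry_parsed:
  assumes "parsed js s (length js) 0" "h < length js" "i < length (js ! h)"
  shows "entry s (1 + offset js h + i) (h + 1) (js ! h ! i)"
  using assms by (auto simp: parsed_def)

text \<open>This reads the bank \<open>job\<close> backwards, from a job number to the positions
  that carry it, because the program recognises the next layer by its job number alone.\<close>

lemma job_position_iff:
  assumes "parsed js s (length js) 0" "s ''job'' (1 + offset js (length js)) = length js + 1"
    "b \<le> 1 + offset js (length js)"
  shows "s ''job'' b = j \<longleftrightarrow> b = 0 \<and> j = 0 \<or>
    (\<exists>h<length js. \<exists>i<length (js ! h). b = 1 + offset js h + i \<and> j = h + 1) \<or>
    b = 1 + offset js (length js) \<and> j = length js + 1"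
proof -
  consider "b = 0" | "1 \<le> b" "b \<le> offset js (length js)" | "b = 1 + offset js (length js)"
    using assms(3) by linarith
  then show ?thesis
  proof cases
    case 1
    then show ?thesis using assms(1) by (auto simp: parsed_def)
  next
    case 2
    then obtain h i where hi: "h < length js" "i < length (js ! h)" "b = 1 + offset js h + i"
      using offset_decompose[of b js "length js"] by auto
    then have job: "s ''job'' b = h + 1" using entry_parsed[OF assms(1)] by (simp add: entry_def)
    have "h' = h" if "h' < length js" "i' < length (js ! h')" "b = 1 + offset js h' + i'" for h' i'
      using that hi offset_less[of h' h js i'] offset_less[of h h' js i] by (cases h h' rule: linorder_cases) auto
    then show ?thesis using job hi 2 by auto
  next
    case 3
    have "b \<noteq> 1 + offset js h + i" if "h < length js" "i < length (js ! h)" for h i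
      using that offset_less[of h "length js" js i] 3 by simp
    then have "\<not> (\<exists>h<length js. \<exists>i<length (js ! h). b = 1 + offset js h + i \<and> j = h + 1)"
      by blast
    then show ?thesis using 3 assms(2) by auto
  qed
qed

text \<open>Provides the topological order required by \<open>best\<close>: the positions of a job
  lie behind those of the preceding job.\<close>

lemma option_greater:
  assumes "parsed js s (length js) 0" "s ''g'' 0 = 1 + offset js (length js)"
    "s ''job'' (s ''g'' 0) = length js + 1" "a < s ''g'' 0" "is_option s a b"
  shows "a < b"
proof (rule ccontr)
  assume "\<not> a < b"
  have b: "b \<le> 1 + offset js (length js)" and job: "s ''job'' b = s ''job'' a + 1"
    using assms(2,5) by (auto simp: is_option_def)
  have a: "a \<le> 1 + offset js (length js)" "a \<noteq> 1 + offset js (length js)" using assms(2,4) by auto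
  note iff = job_position_iff[OF assms(1) assms(3)[unfolded assms(2)]]
  have "b < 1 + offset js (length js)" using \<open>\<not> a < b\<close> a by simp
  then obtain h i where b_eq: "h < length js" "i < length (js ! h)" "b = 1 + offset js h + i"
    "s ''job'' a = h"
    using iff[OF b, of "s ''job'' b"] job by auto
  then have "1 \<le> a" using \<open>\<not> a < b\<close> by simp
  then obtain h' i' where "h' < length js" "i' < length (js ! h')" "a = 1 + offset js h' + i'" "h = h' + 1"
    using iff[OF a(1), of "s ''job'' a"] b_eq(4) a(2) by auto
  then show False
    using offset_less[of h' h js i'] b_eq \<open>\<not> a < b\<close> by simp
qed

lemma upt_shift: "[m..<m + k] = map (\<lambda>i. m + i) [0..<k]"
  by (induction k) simp_all

lemma map_upt_offset:
  "h \<le> length js \<Longrightarrow> map f [1..<1 + offset js h] =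
    concat (map (\<lambda>j. map (\<lambda>i. f (1 + offset js j + i)) [0..<length (js ! j)]) [0..<h])"
proof (induction h)
  case (Suc h)
  have "[1..<1 + offset js (Suc h)] =
      [1..<1 + offset js h] @ [1 + offset js h..<1 + offset js h + length (js ! h)]"
    using upt_add_eq_append[of 1 "1 + offset js h" "length (js ! h)"] offset_Suc[of h js] Suc.prems
    by (simp add: add.assoc)
  then have "map f [1..<1 + offset js (Suc h)] = map f [1..<1 + offset js h] @
      map (\<lambda>i. f (1 + offset js h + i)) [0..<length (js ! h)]"
    by (simp only: upt_shift[of "1 + offset js h"] map_append map_map comp_def)
  then show ?case using Suc by simp
qed simp

lemma map_upt_four:
  "map f [m..<m + 4 * n] = concat (map (\<lambda>h. map (\<lambda>r. f (m + 4 * h + r)) [0..<4]) [0..<n])"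
proof (induction n)
  case (Suc n)
  have "m + 4 * Suc n = m + 4 * n + 4" by simp
  then have "[m..<m + 4 * Suc n] = [m..<m + 4 * n] @ [m + 4 * n..<m + 4 * n + 4]"
    using upt_add_eq_append[of m "m + 4 * n" 4] by (simp only:)
  then have "map f [m..<m + 4 * Suc n] = map f [m..<m + 4 * n] @ map (\<lambda>r. f (m + 4 * n + r)) [0..<4]"
    by (simp only: upt_shift[of "m + 4 * n" 4] map_append map_map comp_def)
  moreover have "concat (map g [0..<Suc n]) = concat (map g [0..<n]) @ g n" for g :: "nat \<Rightarrow> 'a list"
    by simp
  ultimately show ?case using Suc by (simp only:)
qed simp

section \<open>Correctness of the computed schedule\<close>

text \<open>Apart from loop counters, no phase overwrites a bank filled by an earlier one. The
  results of all phases therefore hold together in the last store, and correctness becomes a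
  statement about \<open>t\<close> without any program.\<close>

locale final_store =
  fixes js :: "operation list list" and t :: store
  assumes nonempty: "js \<noteq> []"
    and job: "\<And>ops. ops \<in> set js \<Longrightarrow> fixb_job 2 ops"
    and parsed: "parsed js t (length js) 0"
    and end_position: "t ''g'' 0 = 1 + offset js (length js)"
    and end_job: "t ''job'' (1 + offset js (length js)) = length js + 1"
    and V: "\<And>x. x < 2 * t ''g'' 0 \<Longrightarrow>
      t ''V'' x = t ''num'' x * (\<Prod>y\<in>{2..<2 * t ''g'' 0} - {x}. t ''den'' y)"
    and V_end: "t ''V'' (2 * t ''g'' 0 + 1) = 1"
    and PA: "\<And>a. a \<le> t ''g'' 0 \<Longrightarrow> t ''PA'' a = part_sum t (\<lambda>b. b < a) 0 a (t ''g'' 0 + 1)"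
    and PB: "\<And>a. a \<le> t ''g'' 0 \<Longrightarrow> t ''PB'' a = part_sum t (\<lambda>b. a \<le> b) 1 a (t ''g'' 0 + 1)"
    and G_end: "t ''G'' (t ''g'' 0) = 0"
    and best: "\<And>a. a < t ''g'' 0 \<Longrightarrow> best_below t (t ''g'' 0 + 1) (t ''next'') (t ''G'') a"
    and C_0: "t ''C'' 0 = 0"
    and C_Suc: "\<And>h. h < length js \<Longrightarrow> t ''C'' (Suc h) = t ''next'' (t ''C'' h)"
begin

abbreviation "n \<equiv> length js"

abbreviation pos :: "nat \<Rightarrow> nat \<Rightarrow> nat" where
  "pos h l \<equiv> 1 + offset js h + l"

lemma n_pos: "0 < n"
  using nonempty by simp

lemma fixb_job: "h < n \<Longrightarrow> fixb_job 2 (js ! h)"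
  using job by simp

lemma ptime_pos:
  assumes "h < n" "i < length (js ! h)" "k \<in> machine_set (js ! h ! i)"
  shows "0 < ptime (js ! h ! i) k"
proof -
  have "\<forall>x \<in> set (js ! h). \<forall>k \<in> machine_set x. 0 < ptime x k"
    using conjunct1[OF fixb_job[OF assms(1), unfolded fixb_job_def]] by simp
  then show ?thesis using assms(2,3) nth_mem by blast
qed

lemma pos_less: "h < n \<Longrightarrow> i < length (js ! h) \<Longrightarrow> pos h i < t ''g'' 0"
  using offset_less[of h n js i] end_position by simp

lemma job_iff:
  assumes "b \<le> t ''g'' 0"
  shows "t ''job'' b = j \<longleftrightarrow> b = 0 \<and> j = 0 \<or>
    (\<exists>h<n. \<exists>i<length (js ! h). b = pos h i \<and> j = h + 1) \<or> b = t ''g'' 0 \<and> j = n + 1"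
  using job_position_iff[OF parsed end_job, of b j] assms unfolding end_position .

lemma entry: "h < n \<Longrightarrow> i < length (js ! h) \<Longrightarrow> entry t (pos h i) (h + 1) (js ! h ! i)"
  by (rule entry_parsed[OF parsed])

definition D :: nat where
  "D = (\<Prod>y\<in>{2..<2 * t ''g'' 0}. t ''den'' y)"

lemma den_pos:
  assumes "y \<in> {2..<2 * t ''g'' 0}"
  shows "0 < t ''den'' y"
proof -
  have "1 \<le> y div 2" "y div 2 \<le> offset js n" using assms end_position by auto
  then obtain h i where hi: "h < n" "i < length (js ! h)" "y div 2 = pos h i"
    using offset_decompose[of "y div 2" js n] by auto
  have "y = 2 * pos h i \<or> y = 2 * pos h i + 1" using hi(3) by presburger
  then show ?thesis using entry[OF hi(1,2)] by (elim disjE) (simp_all add: entry_def op_den_pos)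
qed

lemma D_pos: "0 < D"
  unfolding D_def using den_pos by (intro prod_pos) blast

lemma V_0: "t ''V'' 0 = D"
proof -
  have "{2..<2 * t ''g'' 0} - {0} = {2..<2 * t ''g'' 0}" by auto
  then show ?thesis using V[of 0] parsed end_position by (simp add: D_def parsed_def)
qed

text \<open>\<open>D\<close> is the denominator of the cell times the product of the others, so
  scaling cancels the denominator exactly. As \<open>D\<close> is positive, the cells of
  \<open>V\<close> still tell which machines can process the operation.\<close>

lemma V_pos:
  assumes "h < n" "i < length (js ! h)" "k < 2"
  shows "real (t ''V'' (2 * pos h i + k)) = D * real_of_rat (op_time (js ! h ! i) k)"
    and "0 < t ''V'' (2 * pos h i + k) \<longleftrightarrow> k \<in> machine_set (js ! h ! i)"
proof -
  define x where "x = 2 * pos h i + k"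
  define R where "R = (\<Prod>y\<in>{2..<2 * t ''g'' 0} - {x}. t ''den'' y)"
  have x: "x \<in> {2..<2 * t ''g'' 0}" using pos_less[OF assms(1,2)] assms(3) by (simp add: x_def)
  have k: "k = 0 \<or> k = 1" using assms(3) by auto
  have num: "t ''num'' x = op_num (js ! h ! i) k" and den: "t ''den'' x = op_den (js ! h ! i) k"
    using entry[OF assms(1,2)] k by (auto simp: entry_def x_def)
  have Vx: "t ''V'' x = op_num (js ! h ! i) k * R" using V[of x] x num by (simp add: R_def)
  have D: "D = op_den (js ! h ! i) k * R"
    unfolding D_def R_def den[symmetric] using x by (intro prod.remove) auto
  note num_eq = op_num_eq[of k "js ! h ! i", OF ptime_pos[OF assms(1,2)]]
  show "real (t ''V'' (2 * pos h i + k)) = D * real_of_rat (op_time (js ! h ! i) k)"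
    unfolding x_def[symmetric] Vx D using num_eq(1) by simp
  show "0 < t ''V'' (2 * pos h i + k) \<longleftrightarrow> k \<in> machine_set (js ! h ! i)"
    unfolding x_def[symmetric] Vx using num_eq(2) D D_pos by simp
qed

lemma part_sum_pos:
  assumes "h < n" "l < length (js ! h)" "k < 2" "t ''job'' a = h + 1"
  shows "real (part_sum t R k a (t ''g'' 0 + 1)) =
    D * real_of_rat (\<Sum>i | i < length (js ! h) \<and> R (pos h i). op_time (js ! h ! i) k)"
proof -
  define I where "I = {i. i < length (js ! h) \<and> R (pos h i)}"
  have "{b \<in> {..<t ''g'' 0 + 1}. R b \<and> t ''job'' b = t ''job'' a} = pos h ` I" (is "?B = _")
  proof (intro set_eqI iffI)
    fix b assume b: "b \<in> ?B"
    then have "t ''job'' b = h + 1" "b \<le> t ''g'' 0" "R b" using assms(4) by simp_all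
    moreover from this obtain i where "i < length (js ! h)" "b = pos h i"
      using job_iff[of b "h + 1"] assms(1) by auto
    ultimately show "b \<in> pos h ` I" unfolding I_def by blast
  next
    fix b assume "b \<in> pos h ` I"
    then obtain i where i: "i < length (js ! h)" "R (pos h i)" "b = pos h i"
      unfolding I_def by blast
    then have "t ''job'' b = h + 1" using entry[OF assms(1) i(1)] by (simp only: entry_def)
    moreover have "b < t ''g'' 0 + 1" using pos_less[OF assms(1) i(1)] i(3) by linarith
    ultimately show "b \<in> ?B" using i(2,3) assms(4) by simp
  qed
  moreover have "part_sum t R k a (t ''g'' 0 + 1) = (\<Sum>b\<in>?B. t ''V'' (2 * b + k))"
    unfolding part_sum_def by (rule sum.inter_filter[symmetric]) (rule finite_lessThan)
  moreover have "inj_on (pos h) I" by (rule inj_onI) linarith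
  ultimately have "part_sum t R k a (t ''g'' 0 + 1) = (\<Sum>i\<in>I. t ''V'' (2 * pos h i + k))"
    by (simp only: sum.reindex comp_def)
  then have "real (part_sum t R k a (t ''g'' 0 + 1)) = (\<Sum>i\<in>I. real (t ''V'' (2 * pos h i + k)))"
    by (simp only: of_nat_sum)
  also have "\<dots> = (\<Sum>i\<in>I. D * real_of_rat (op_time (js ! h ! i) k))"
  proof (rule sum.cong[OF refl])
    show "real (t ''V'' (2 * pos h i + k)) = D * real_of_rat (op_time (js ! h ! i) k)"
      if "i \<in> I" for i
      by (rule V_pos(1)[OF assms(1) _ assms(3)]) (use that in \<open>simp add: I_def\<close>)
  qed
  also have "\<dots> = D * real_of_rat (\<Sum>i\<in>I. op_time (js ! h ! i) k)"
    by (simp only: sum_distrib_left of_rat_sum)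
  finally show ?thesis unfolding I_def .
qed

definition head :: "nat \<Rightarrow> nat \<Rightarrow> real" where
  "head h l = real_of_rat (head_time (js ! h) l)"

definition tail :: "nat \<Rightarrow> nat \<Rightarrow> real" where
  "tail h l = real_of_rat (tail_time (js ! h) l)"

lemma PA_pos:
  assumes "h < n" "l < length (js ! h)"
  shows "real (t ''PA'' (pos h l)) = D * head h l"
proof -
  have "{i. i < length (js ! h) \<and> pos h i < pos h l} = {..<l}" using assms(2) by auto
  then show ?thesis
    using part_sum_pos[OF assms, of 0 "pos h l" "\<lambda>b. b < pos h l"] entry[OF assms]
      PA[of "pos h l"] pos_less[OF assms]
    by (simp add: head_def head_time_def entry_def)
qed

lemma PB_pos:
  assumes "h < n" "l < length (js ! h)"
  shows "real (t ''PB'' (pos h l)) = D * tail h l"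
proof -
  have "{i. i < length (js ! h) \<and> pos h l \<le> pos h i} = {l..<length (js ! h)}" by auto
  then show ?thesis
    using part_sum_pos[OF assms, of 1 "pos h l" "\<lambda>b. pos h l \<le> b"] entry[OF assms]
      PB[of "pos h l"] pos_less[OF assms]
    by (simp add: tail_def tail_time_def entry_def)
qed

text \<open>The artificial start has no time on the second machine, so the first arc costs just the
  first job's time on the first machine; \<open>PA_end\<close> plays the symmetric part for the last
  arc.\<close>

lemma PB_0: "t ''PB'' 0 = 0"
proof -
  have "t ''V'' 1 = 0" using V[of 1] parsed end_position by (simp add: parsed_def)
  have "(if 0 \<le> b \<and> t ''job'' b = t ''job'' 0 then t ''V'' (2 * b + 1) else 0) = 0"
    if "b \<in> {..<t ''g'' 0 + 1}" for b
  proof (cases "t ''job'' b = 0")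
    case True
    then have "b = 0" using job_iff[of b 0] that by simp
    then show ?thesis using \<open>t ''V'' 1 = 0\<close> by simp
  qed (use parsed in \<open>simp add: parsed_def\<close>)
  then have "part_sum t (\<lambda>b. 0 \<le> b) 1 0 (t ''g'' 0 + 1) = 0"
    unfolding part_sum_def by (intro sum.neutral) blast
  then show ?thesis using PB[of 0] by simp
qed

lemma PA_end: "t ''PA'' (t ''g'' 0) = 0"
proof -
  have "t ''job'' b \<noteq> t ''job'' (t ''g'' 0)" if "b < t ''g'' 0" for b
    using job_iff[of b "n + 1"] that end_job end_position by auto
  then have "part_sum t (\<lambda>b. b < t ''g'' 0) 0 (t ''g'' 0) (t ''g'' 0 + 1) = 0"
    unfolding part_sum_def by (intro sum.neutral) auto
  then show ?thesis using PA[of "t ''g'' 0"] by simp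
qed

section \<open>Layers, arcs and the Bellman equations of the graph\<close>

lemma option_iff:
  assumes "t ''job'' a = j" "j < n"
  shows "is_option t a b \<longleftrightarrow> (\<exists>l. cut (js ! j) l \<and> b = pos j l)"
proof
  assume *: "is_option t a b"
  then obtain l where l: "l < length (js ! j)" "b = pos j l"
    using job_iff[of b "j + 1"] assms by (auto simp: is_option_def)
  then have "1 \<in> machine_set (js ! j ! l)"
    using * V_pos(2)[OF assms(2) l(1), of 1] by (simp add: is_option_def)
  then show "\<exists>l. cut (js ! j) l \<and> b = pos j l" using l by (auto simp: cut_def)
next
  assume "\<exists>l. cut (js ! j) l \<and> b = pos j l"
  then obtain l where l: "l < length (js ! j)" "1 \<in> machine_set (js ! j ! l)" "b = pos j l"
    by (auto simp: cut_def)
  have "t ''job'' b = j + 1" using entry[OF assms(2) l(1)] l(3) by (simp add: entry_def)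
  then show "is_option t a b"
    using pos_less[OF assms(2) l(1)] V_pos(2)[OF assms(2) l(1), of 1] l assms(1)
    by (simp add: is_option_def)
qed

lemma option_end:
  assumes "t ''job'' a = n"
  shows "is_option t a b \<longleftrightarrow> b = t ''g'' 0"
proof -
  have "b = t ''g'' 0 \<longleftrightarrow> t ''job'' b = n + 1" if "b \<le> t ''g'' 0"
    using job_iff[OF that, of "n + 1"] by auto
  then show ?thesis using assms V_end by (auto simp: is_option_def)
qed

text \<open>Layer 0 consists of the artificial start, layer \<open>h > 0\<close> of the cuts of the
  job with list index \<open>h - 1\<close>. The artificial end is in no layer.\<close>

definition state :: "nat \<Rightarrow> nat \<Rightarrow> bool" where
  "state h a \<longleftrightarrow> h = 0 \<and> a = 0 \<or> (\<exists>l. 0 < h \<and> h \<le> n \<and> cut (js ! (h - 1)) l \<and> a = pos (h - 1) l)"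

lemma state_job:
  assumes "state h a"
  shows "t ''job'' a = h" "a < t ''g'' 0"
proof -
  have "t ''job'' a = h \<and> a < t ''g'' 0"
  proof (cases "h = 0")
    case True
    then show ?thesis using assms parsed end_position by (simp add: state_def parsed_def)
  next
    case False
    then obtain l where l: "h - 1 < n" "l < length (js ! (h - 1))" "a = pos (h - 1) l"
      using assms by (auto simp: state_def cut_def)
    then show ?thesis using entry[OF l(1,2)] pos_less[OF l(1,2)] False by (simp add: entry_def)
  qed
  then show "t ''job'' a = h" "a < t ''g'' 0" by auto
qed

lemma state_option: "state h a \<Longrightarrow> h < n \<Longrightarrow> is_option t a b \<longleftrightarrow> state (Suc h) b"
  using option_iff[of a h b] state_job(1)[of h a] by (auto simp: state_def)

lemma exists_state: "h < n \<Longrightarrow> \<exists>b. state (Suc h) b"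
  using exists_cut[OF fixb_job[of h]] by (auto simp: state_def)

lemma G_le:
  assumes "state h a" "h < n" "state (Suc h) b"
  shows "t ''G'' a \<le> step_cost t a b + t ''G'' b"
proof -
  have *: "is_option t a b" using assms state_option by blast
  then have "b < t ''g'' 0 + 1" by (simp add: is_option_def)
  then show ?thesis using best[OF state_job(2)[OF assms(1)]] * unfolding best_below_def by meson
qed

lemma G_next:
  assumes "state h a" "h < n"
  shows "state (Suc h) (t ''next'' a)"
    and "t ''G'' a = step_cost t a (t ''next'' a) + t ''G'' (t ''next'' a)"
proof -
  obtain b where *: "is_option t a b" using assms state_option exists_state by blast
  then have "b < t ''g'' 0 + 1" by (simp add: is_option_def)
  then have "is_option t a (t ''next'' a)"
    "t ''G'' a = step_cost t a (t ''next'' a) + t ''G'' (t ''next'' a)"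
    using best[OF state_job(2)[OF assms(1)]] * unfolding best_below_def by meson+
  then show "state (Suc h) (t ''next'' a)"
    "t ''G'' a = step_cost t a (t ''next'' a) + t ''G'' (t ''next'' a)"
    using assms state_option by blast+
qed

text \<open>The end is the only continuation; \<open>G\<close> and \<open>PA\<close> vanish there,
  so the maximum in the arc cost reduces to \<open>PB a\<close>.\<close>

lemma G_last:
  assumes "state n a"
  shows "t ''G'' a = t ''PB'' a"
proof -
  have opt: "is_option t a b \<longleftrightarrow> b = t ''g'' 0" for b
    using option_end state_job(1)[OF assms] by blast
  then have "is_option t a (t ''next'' a) \<and>
      t ''G'' a = step_cost t a (t ''next'' a) + t ''G'' (t ''next'' a)"
    using best[OF state_job(2)[OF assms]] unfolding best_below_def by (metis less_add_one)
  then show ?thesis using opt G_end PA_end by (simp add: step_cost_def)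
qed

lemma state_C: "h \<le> n \<Longrightarrow> state h (t ''C'' h)"
proof (induction h)
  case (Suc h)
  then show ?case using G_next(1)[of h] C_Suc[of h] by simp
qed (simp add: state_def C_0)

lemma G_C: "h < n \<Longrightarrow> t ''G'' (t ''C'' h) =
    step_cost t (t ''C'' h) (t ''C'' (Suc h)) + t ''G'' (t ''C'' (Suc h))"
  using G_next(2)[OF state_C[of h]] C_Suc[of h] by simp

lemma G_C_le: "h \<le> n \<Longrightarrow> t ''G'' (t ''C'' h) \<le> t ''G'' 0"
proof (induction h)
  case (Suc h)
  then show ?case using G_C[of h] by simp
qed (simp add: C_0)

section \<open>The schedule read off from the shortest path\<close>

definition chosen_cut :: "nat \<Rightarrow> nat" where
  "chosen_cut h = t ''C'' (Suc h) - (1 + offset js h)"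

lemma chosen_cut:
  assumes "h < n"
  shows "cut (js ! h) (chosen_cut h)" "t ''C'' (Suc h) = pos h (chosen_cut h)"
  using state_C[of "Suc h"] assms by (auto simp: state_def chosen_cut_def)

text \<open>This is the length of the path travelled up to layer \<open>h\<close>, scaled back by
  \<open>D\<close>. The subtraction does not truncate for \<open>h \<le> n\<close>, by
  \<open>G_C_le\<close>.\<close>

definition start_time :: "nat \<Rightarrow> real" where
  "start_time h = real (t ''G'' 0 - t ''G'' (t ''C'' h)) / D"

lemma D_start_time: "h \<le> n \<Longrightarrow> D * start_time h = real (t ''G'' 0) - real (t ''G'' (t ''C'' h))"
  using G_C_le[of h] D_pos by (simp add: start_time_def of_nat_diff)

lemma start_time_Suc:
  assumes "h < n"
  shows "D * start_time (Suc h) = D * start_time h + step_cost t (t ''C'' h) (t ''C'' (Suc h))"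
  using G_C[OF assms] D_start_time[of h] D_start_time[of "Suc h"] assms by simp

lemma step_cost_ge:
  "real (t ''PA'' b) \<le> step_cost t a b" "real (t ''PB'' a) \<le> step_cost t a b"
  by (simp_all add: step_cost_def)

text \<open>An arc cost is a maximum of two times; this bound uses one of them and
  \<open>start_time_tail\<close> the other.\<close>

lemma start_time_head:
  assumes "h < n"
  shows "start_time h + head h (chosen_cut h) \<le> start_time (Suc h)"
proof -
  have "D * head h (chosen_cut h) \<le> step_cost t (t ''C'' h) (t ''C'' (Suc h))"
    using PA_pos[OF assms, of "chosen_cut h"] chosen_cut[OF assms]
      step_cost_ge(1)[of "t ''C'' (Suc h)" "t ''C'' h"]
    by (simp add: cut_def)
  then have "D * (start_time h + head h (chosen_cut h)) \<le> D * start_time (Suc h)"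
    using start_time_Suc[OF assms] by (simp add: distrib_left)
  then show ?thesis using D_pos by simp
qed

lemma start_time_tail:
  assumes "Suc h < n"
  shows "start_time (Suc h) + tail h (chosen_cut h) \<le> start_time (Suc (Suc h))"
proof -
  have "D * tail h (chosen_cut h) \<le> step_cost t (t ''C'' (Suc h)) (t ''C'' (Suc (Suc h)))"
    using PB_pos[of h "chosen_cut h"] chosen_cut[of h] assms
      step_cost_ge(2)[of "t ''C'' (Suc h)" "t ''C'' (Suc (Suc h))"]
    by (simp add: cut_def)
  then have "D * (start_time (Suc h) + tail h (chosen_cut h)) \<le> D * start_time (Suc (Suc h))"
    using start_time_Suc[OF assms] by (simp add: distrib_left)
  then show ?thesis using D_pos by simp
qed

lemma makespan_eq: "D * (start_time n + tail (n - 1) (chosen_cut (n - 1))) = t ''G'' 0"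
proof -
  have n: "n - 1 < n" "Suc (n - 1) = n" using n_pos by auto
  have "real (t ''G'' (t ''C'' n)) = D * tail (n - 1) (chosen_cut (n - 1))"
    using G_last[OF state_C[of n]] PB_pos[OF n(1), of "chosen_cut (n - 1)"] chosen_cut[OF n(1)] n(2)
    by (simp add: cut_def)
  then show ?thesis using D_start_time[of n] by (simp add: distrib_left)
qed

text \<open>Along any schedule, the scaled starting time on the second machine plus the optimal remaining cost never drops below the optimum.\<close>

lemma makespan_ge:
  assumes cuts: "\<And>h. h < n \<Longrightarrow> cut (js ! h) (l h)"
    and nonneg: "0 \<le> a 0"
    and line: "\<And>h. h < n \<Longrightarrow> a h + head h (l h) \<le> b h"
    and machine: "\<And>h. Suc h < n \<Longrightarrow> b h + tail h (l h) \<le> b (Suc h)"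
    and blocking: "\<And>h. Suc h < n \<Longrightarrow> b h \<le> a (Suc h)"
  shows "t ''G'' 0 \<le> D * (b (n - 1) + tail (n - 1) (l (n - 1)))"
proof -
  have st: "state (Suc h) (pos h (l h))" if "h < n" for h
    using cuts[OF that] that by (auto simp: state_def)
  have len: "l h < length (js ! h)" if "h < n" for h using cuts[OF that] by (simp add: cut_def)
  have "t ''G'' 0 \<le> D * b h + t ''G'' (pos h (l h))" if "h < n" for h
    using that
  proof (induction h)
    case 0
    have "t ''G'' 0 \<le> step_cost t 0 (pos 0 (l 0)) + t ''G'' (pos 0 (l 0))"
      using G_le[of 0 0] st[of 0] n_pos by (simp add: state_def)
    moreover have "real (step_cost t 0 (pos 0 (l 0))) = D * head 0 (l 0)"
      using PA_pos[OF n_pos len[OF n_pos]] PB_0 by (simp add: step_cost_def)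
    moreover have "D * head 0 (l 0) \<le> D * b 0"
      using line[OF n_pos] nonneg by (intro mult_left_mono) auto
    ultimately show ?case by linarith
  next
    case (Suc h)
    then have h: "h < n" by simp
    have "t ''G'' (pos h (l h)) \<le> step_cost t (pos h (l h)) (pos (Suc h) (l (Suc h))) +
        t ''G'' (pos (Suc h) (l (Suc h)))"
      using G_le[OF st[OF h] _ st[OF Suc.prems]] Suc.prems by simp
    moreover have "real (step_cost t (pos h (l h)) (pos (Suc h) (l (Suc h)))) =
        max (D * head (Suc h) (l (Suc h))) (D * tail h (l h))"
      using PA_pos[OF Suc.prems len[OF Suc.prems]] PB_pos[OF h len[OF h]]
      by (simp add: step_cost_def of_nat_max)
    \<comment> \<open>The second machine forces \<open>b\<close> to grow by at least the tail, line
      and blocking constraints together by at least the head. The growth is thus no less than the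
      arc cost.\<close>
    moreover have "D * (b h + tail h (l h)) \<le> D * b (Suc h)"
      using machine[OF Suc.prems] by (intro mult_left_mono) auto
    moreover have "D * (b h + head (Suc h) (l (Suc h))) \<le> D * b (Suc h)"
      using line[OF Suc.prems] blocking[OF Suc.prems] by (intro mult_left_mono) auto
    ultimately show ?case using Suc.IH[OF h] by (simp add: distrib_left)
  qed
  moreover have n: "n - 1 < n" "Suc (n - 1) = n" using n_pos by auto
  moreover have "real (t ''G'' (pos (n - 1) (l (n - 1)))) = D * tail (n - 1) (l (n - 1))"
    using G_last[of "pos (n - 1) (l (n - 1))"] st[OF n(1)] n(2) PB_pos[OF n(1) len[OF n(1)]] by simp
  ultimately show ?thesis by (metis distrib_left)
qed

lemma pos_ptime_cut:
  assumes "jobs I = js" "job_at S = id" "h < n" "cut (js ! h) l"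
    "\<And>i. i < length (js ! h) \<Longrightarrow> mode S h i = cut_mode l i"
  shows "pos_ptime I S h 0 = head h l" "pos_ptime I S h 1 = tail h l"
  using total_ptime_cut[OF fixb_job[OF assms(3)] assms(4,5)] assms(1,2)
  by (simp_all add: pos_ptime_def head_def tail_def)

text \<open>The modes of a feasible schedule are cuts and so trace a path. Its starting times may be
  arbitrary reals, since \<open>makespan_ge\<close> is stated for real sequences.\<close>

lemma optimum_le_makespan:
  assumes I: "machines I = 2" "jobs I = js" and S: "feasible_fixed_seq I S"
  shows "t ''G'' 0 \<le> D * makespan I S"
proof -
  have feas: "feasible I S" and id: "job_at S = id"
    using S by (simp_all add: feasible_fixed_seq_def)
  have "\<forall>h<n. \<exists>l. cut (js ! h) l \<and> (\<forall>i<length (js ! h). mode S h i = cut_mode l i)"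
  proof (intro allI impI)
    fix h assume h: "h < n"
    have "assignment_mode (js ! h) (mode S h)" using feas h I(2) by (simp add: feasible_def)
    then show "\<exists>l. cut (js ! h) l \<and> (\<forall>i<length (js ! h). mode S h i = cut_mode l i)"
      by (rule cut_of_assignment_mode[OF fixb_job[OF h]])
  qed
  then obtain l where l: "\<And>h. h < n \<Longrightarrow> cut (js ! h) (l h)"
    "\<And>h i. h < n \<Longrightarrow> i < length (js ! h) \<Longrightarrow> mode S h i = cut_mode (l h) i" by metis
  have ptime: "pos_ptime I S h 0 = head h (l h)" "pos_ptime I S h 1 = tail h (l h)" if "h < n" for h
    using pos_ptime_cut[OF I(2) id that l(1)[OF that] l(2)[OF that]] by simp_all
  have "t ''G'' 0 \<le> D * (start S (n - 1) 1 + tail (n - 1) (l (n - 1)))"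
  proof (rule makespan_ge[where a = "\<lambda>h. start S h 0" and b = "\<lambda>h. start S h 1", OF l(1)])
    show "0 \<le> start S 0 0"
      using feas n_pos I by (auto simp: feasible_def)
  next
    fix h assume h: "h < n"
    have "start S h 0 + pos_ptime I S h 0 \<le> start S h (0 + 1)"
      using feas h I unfolding feasible_def by (metis add_0 one_less_numeral_iff semiring_norm(76))
    then show "start S h 0 + head h (l h) \<le> start S h 1" using ptime[OF h] by simp
  next
    fix h assume h: "Suc h < n"
    have "start S h 1 + pos_ptime I S h 1 \<le> start S (h + 1) 1"
      using feas h I unfolding feasible_def by (metis Suc_eq_plus1 one_less_numeral_iff semiring_norm(76))
    then show "start S h 1 + tail h (l h) \<le> start S (Suc h) 1" using ptime[of h] h by simp
  next
    fix h assume h: "Suc h < n"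
    have "start S h (0 + 1) \<le> start S (h + 1) 0"
      using feas h I unfolding feasible_def
      by (metis Suc_eq_plus1 add_0 one_less_numeral_iff semiring_norm(76))
    then show "start S h 1 \<le> start S (Suc h) 0" by simp
  qed
  also have "start S (n - 1) 1 + tail (n - 1) (l (n - 1)) = makespan I S"
    using ptime(2)[of "n - 1"] n_pos I by (simp add: makespan_def)
  finally show ?thesis .
qed

lemma optimal_answer:
  assumes I: "machines I = 2" "jobs I = js"
    and length: "t ''output'' 0 = t ''g'' 0 - 1 + 4 * n"
    and modes: "\<And>i. i \<in> {1..<t ''g'' 0} \<Longrightarrow> t ''output'' i = 1 - (t ''C'' (t ''job'' i) - i)"
    and times: "\<And>h r. h < n \<Longrightarrow> r < 4 \<Longrightarrow> t ''output'' (t ''g'' 0 + 4 * h + r) = time_entry t h r"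
  shows "\<exists>S. encodes_schedule I S (output_words t) \<and> optimal_fixed_seq I S"
proof -
  \<comment> \<open>A job enters the first machine when its predecessor enters the second, so the
    blocking constraint holds with equality.\<close>
  define S where "S = \<lparr>mode = \<lambda>j i. t ''output'' (pos j i), job_at = id,
    start = \<lambda>h k. start_time (h + k)\<rparr>"
  have S: "mode S = (\<lambda>j i. t ''output'' (pos j i))" "job_at S = id"
    "start S = (\<lambda>h k. start_time (h + k))" by (simp_all add: S_def)
  have mode: "mode S h i = cut_mode (chosen_cut h) i" if "h < n" "i < length (js ! h)" for h i
  proof -
    have "t ''job'' (pos h i) = Suc h" using entry[OF that] by (simp add: entry_def)
    then have "mode S h i = 1 - (pos h (chosen_cut h) - pos h i)"
      using modes[of "pos h i"] pos_less[OF that] chosen_cut(2)[OF that(1)] unfolding S by simp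
    then show ?thesis by (auto simp: cut_mode_def)
  qed
  have ptime: "pos_ptime I S h 0 = head h (chosen_cut h)" "pos_ptime I S h 1 = tail h (chosen_cut h)"
    if "h < n" for h
    using pos_ptime_cut[OF I(2) S(2) that chosen_cut(1)[OF that] mode[OF that]] by simp_all
  have head_nonneg: "start_time (Suc h) \<ge> start_time h" if "h < n" for h
  proof -
    have "D * start_time h \<le> D * start_time (Suc h)" using start_time_Suc[OF that] by simp
    then show ?thesis using D_pos by simp
  qed
  have feas: "feasible I S"
    unfolding feasible_def I
  proof (intro conjI allI impI)
    fix j assume "j < n"
    then show "assignment_mode (js ! j) (mode S j)"
      using assignment_mode_cong[OF assignment_mode_cut[OF fixb_job chosen_cut(1)]] mode by blast
  next
    show "job_at S permutes {..<n}" unfolding S by (rule permutes_id)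
  next
    fix h k
    show "0 \<le> start S h k" by (simp add: S start_time_def)
  next
    fix h k :: nat assume "h < n \<and> k + 1 < 2"
    then have h: "h < n" and k: "k = 0" by auto
    show "start S h k + pos_ptime I S h k \<le> start S h (k + 1)"
      using start_time_head[OF h] ptime(1)[OF h] unfolding k S by simp
  next
    fix h k :: nat assume "h + 1 < n \<and> k < 2"
    then have h: "h < n" "Suc h < n" and k: "k = 0 \<or> k = 1" by auto
    show "start S h k + pos_ptime I S h k \<le> start S (h + 1) k"
      using k
    proof
      assume k: "k = 0"
      show ?thesis using start_time_head[OF h(1)] ptime(1)[OF h(1)] unfolding k S by simp
    next
      assume k: "k = 1"
      show ?thesis using start_time_tail[OF h(2)] ptime(2)[OF h(1)] unfolding k S by simp
    qed
  next
    fix h k :: nat assume "h + 1 < n \<and> k + 1 < 2"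
    then have k: "k = 0" by auto
    show "start S h (k + 1) \<le> start S (h + 1) k" unfolding k S by simp
  qed
  have "makespan I S = start_time n + tail (n - 1) (chosen_cut (n - 1))"
    using ptime(2)[of "n - 1"] n_pos unfolding makespan_def I S by simp
  then have "D * makespan I S = t ''G'' 0" using makespan_eq by simp
  then have "makespan I S \<le> makespan I S'" if "feasible_fixed_seq I S'" for S'
    using optimum_le_makespan[OF I that] D_pos by (metis mult_le_cancel_left_pos of_nat_0_less_iff)
  then have "optimal_fixed_seq I S"
    using feas by (simp add: optimal_fixed_seq_def feasible_fixed_seq_def S)
  moreover have "encodes_schedule I S (output_words t)"
    unfolding encodes_schedule_def I
  \<comment> \<open>The numerators are the even entries of \<open>time_entry\<close> and all
    denominators are \<open>D\<close>; the fractions stay unreduced.\<close>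
  proof (intro exI conjI allI impI)
    fix h k :: nat assume "h < n \<and> k < 2"
    show "0 < D" by (rule D_pos)
    show "start S h k = real (time_entry t h (2 * k)) / real D"
      by (simp add: S start_time_def time_entry_def)
  next
    have "Suc (t ''output'' 0) = 1 + offset js n + 4 * n" using length end_position by simp
    then have "[1..<Suc (t ''output'' 0)] =
        [1..<1 + offset js n] @ [1 + offset js n..<1 + offset js n + 4 * n]"
      using upt_add_eq_append[of 1 "1 + offset js n" "4 * n"] by simp
    then have "output_words t = map (t ''output'') [1..<1 + offset js n] @
        map (t ''output'') [1 + offset js n..<1 + offset js n + 4 * n]"
      by (simp only: output_words_def map_append)
    also have "map (t ''output'') [1..<1 + offset js n] =
        concat (map (\<lambda>j. map (mode S j) [0..<length (js ! j)]) [0..<n])"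
      unfolding S by (rule map_upt_offset) simp
    also have "map (t ''output'') [1 + offset js n..<1 + offset js n + 4 * n] = concat (map (\<lambda>h.
        concat (map (\<lambda>k. [time_entry t h (2 * k), D]) [0..<2])) [0..<n])"
      unfolding map_upt_four
    proof (rule arg_cong[where f = concat], rule map_cong[OF refl])
      fix h assume "h \<in> set [0..<n]"
      then have h: "h < n" by simp
      have "[0..<4] = [0, 1, 2, 3::nat]" "[0..<2] = [0, 1::nat]" by (simp_all add: upt_rec)
      moreover have "time_entry t h 1 = D" "time_entry t h 3 = D"
        by (simp_all add: time_entry_def V_0)
      ultimately show "map (\<lambda>r. t ''output'' (1 + offset js n + 4 * h + r)) [0..<4] =
          concat (map (\<lambda>k. [time_entry t h (2 * k), D]) [0..<2])"
        using times[OF h, of 0] times[OF h, of 1] times[OF h, of 2] times[OF h, of 3]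
        unfolding end_position by simp
    qed
    finally show "output_words t = concat (map (\<lambda>j. map (mode S j) [0..<length (js ! j)]) [0..<n]) @
        concat (map (\<lambda>h. concat (map (\<lambda>k. [time_entry t h (2 * k), D]) [0..<2])) [0..<n])" .
  qed
  ultimately show ?thesis by blast
qed

end

section \<open>The complete program\<close>

lemma part_sum_cong:
  "s ''job'' = t ''job'' \<Longrightarrow> s ''V'' = t ''V'' \<Longrightarrow> part_sum s = part_sum t"
  by (intro ext) (simp only: part_sum_def)

lemma best_below_cong:
  assumes "s ''g'' = t ''g''" "s ''job'' = t ''job''" "s ''V'' = t ''V''"
    "s ''PA'' = t ''PA''" "s ''PB'' = t ''PB''"
  shows "best_below s = best_below t"
proof -
  have "is_option s = is_option t" "step_cost s = step_cost t"
    by (intro ext, simp only: is_option_def step_cost_def assms)+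
  then show ?thesis by (intro ext) (simp only: best_below_def)
qed

definition solve :: prog where
  "solve = block [parse, scale, job_sums, best, trace, write_output]"

lemma writes_phases [simp]:
  "writes parse = {''job'', ''num'', ''den'', ''pos'', ''g'', ''end'', ''h''}"
  "writes scale = {''x'', ''y'', ''V''}"
  "writes job_sums = {''a'', ''b'', ''PA'', ''PB''}"
  "writes best = {''i'', ''a'', ''b'', ''G'', ''next''}"
  "writes trace = {''h'', ''C''}"
  "writes write_output = {''i'', ''h'', ''output''}"
  by (auto simp: parse_def scale_def scale_row_def multiply_loop_def job_sums_def best_def
      trace_def write_output_def)

lemma tame_solve: "tame solve"
  by (simp add: solve_def parse_def parse_job_def parse_operations_def parse_operation_def
      store_times_def word_def scale_def scale_row_def multiply_loop_def job_sums_def sums_row_def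
      sums_step_def best_def best_row_def best_choice_def option_cost_def trace_def
      write_output_def write_modes_def write_times_def write_step_def time_index_def
      factor_banks_def)

text \<open>The number of output words is recorded because polynomial-time solvability also charges
  for the output.\<close>

definition solved :: "fixb \<Rightarrow> store \<Rightarrow> bool" where
  "solved I t \<longleftrightarrow> t ''output'' 0 = offset (jobs I) (njobs I) + 4 * njobs I \<and>
     (\<exists>S. encodes_schedule I S (output_words t) \<and> optimal_fixed_seq I S)"

text \<open>The constants of the six phases add up to 3800; the rest pays for their sequential
  composition.\<close>

lemma runs_solve:
  assumes I: "fixb_instance I" "machines I = 2"
    and s: "readable s 3 (concat (map encode_job (jobs I)))" "s ''input'' 2 = njobs I"
      "\<And>x. x \<noteq> ''input'' \<Longrightarrow> s x = (\<lambda>_. 0)"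
    and W: "offset (jobs I) (njobs I) + njobs I < W"
  shows "runs solve (4000 * (W * W)) (solved I) s"
proof -
  define js where "js = jobs I"
  let ?n = "length js"
  obtain Z where Z: "W * W = Z" "1 \<le> Z" using W by simp
  have job: "fixb_job 2 ops" if "ops \<in> set js" for ops
    using I that by (simp add: fixb_instance_def js_def)
  have js: "js \<noteq> []" using I by (auto simp: fixb_instance_def js_def)
  have machine: "machine_set x \<subseteq> {..<2}" if "ops \<in> set js" "x \<in> set ops" for ops x
    using conjunct1[OF job[OF that(1), unfolded fixb_job_def]] that(2) by simp
  have zero: "s ''num'' 1 = 0" "s ''job'' 0 = 0" by (simp_all add: s(3))
  note parse = parse[OF s(1,2)[folded js_def] zero machine W[folded js_def]]
  show ?thesis
    unfolding solve_def block.simps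
  proof (rule runs_Seq[OF parse], goal_cases)
    case (3 t1)
    note t1 = 3(1) and fr1 = 3(2)
    have g1: "1 \<le> t1 ''g'' 0" "t1 ''g'' 0 \<le> W" using t1 W by (auto simp: js_def)
    show ?case
    proof (rule runs_Seq[OF scale[of t1 W, OF g1]], goal_cases)
      case (1 t2)
      note t2 = 1(1) and fr2 = 1(2)
      have g2: "t2 ''g'' = t1 ''g''" using fr2[of "''g''"] by simp
      have z2: "t2 ''PA'' = (\<lambda>_. 0)" "t2 ''PB'' = (\<lambda>_. 0)"
        using fr2[of "''PA''"] fr1[of "''PA''"] fr2[of "''PB''"] fr1[of "''PB''"] s(3) by simp_all
      show ?case
      proof (rule runs_Seq[OF job_sums[of t2 W, OF z2 g1[folded g2]]], goal_cases)
        case (1 t3)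
        note t3 = 1(1) and fr3 = 1(2)
        have e3: "t3 ''g'' = t1 ''g''" "t3 ''job'' = t1 ''job''" "t3 ''num'' = t1 ''num''"
          "t3 ''den'' = t1 ''den''" "t3 ''V'' = t2 ''V''" "t2 ''job'' = t1 ''job''"
          using fr3[of "''g''"] fr2[of "''g''"] fr3[of "''job''"] fr2[of "''job''"]
            fr3[of "''num''"] fr2[of "''num''"] fr3[of "''den''"] fr2[of "''den''"]
            fr3[of "''V''"] by simp_all
        have parsed3: "parsed js t3 ?n 0"
          using t1 parsed_cong[of t3 t1 js ?n 0] e3 by simp
        have z3: "t3 ''next'' = (\<lambda>_. 0)" "t3 ''G'' = (\<lambda>_. 0)"
          using fr3[of "''next''"] fr2[of "''next''"] fr1[of "''next''"]
            fr3[of "''G''"] fr2[of "''G''"] fr1[of "''G''"] s(3) by simp_all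
        have job3: "t3 ''job'' 0 = 0" using parsed3 by (simp add: parsed_def)
        have g3: "t3 ''g'' 0 = 1 + offset js ?n" "t3 ''job'' (t3 ''g'' 0) = ?n + 1"
          using t1 unfolding e3 by blast+
        note greater = option_greater[OF parsed3 g3]
        show ?case
        proof (rule runs_Seq[OF best[of t3 W, OF g1[folded e3(1)] job3 z3 greater]], goal_cases)
          case (3 t4)
          note t4 = 3(1) and fr4 = 3(2)
          have C4: "t4 ''C'' 0 = 0"
            using fr4[of "''C''"] fr3[of "''C''"] fr2[of "''C''"] fr1[of "''C''"] s(3) by simp
          have n4: "t4 ''input'' 2 = ?n"
            using fr4[of "''input''"] fr3[of "''input''"] fr2[of "''input''"] fr1[of "''input''"]
              s(2) by (simp add: js_def)
          have W4: "t4 ''input'' 2 \<le> W" "1 \<le> W" using n4 W by (auto simp: js_def)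
          show ?case
          proof (rule runs_Seq[OF trace[of t4 W, OF C4 W4]], goal_cases)
            case (1 t5)
            note t5 = 1(1) and fr5 = 1(2)
            have g5: "t5 ''g'' = t1 ''g''"
              using fr5[of "''g''"] fr4[of "''g''"] e3(1) by simp
            have n5: "t5 ''input'' 2 = ?n"
              using fr5[of "''input''"] n4 by simp
            have W5: "t5 ''input'' 2 \<le> W" using n5 n4 W4 by simp
            show ?case
            proof (rule runs_mono[OF write_output[of t5 W, OF g1[folded g5] W5]], goal_cases)
              case (2 t)
              note t = 2(1) and fr = 2(2)
              have e: "t ''g'' = t1 ''g''" "t ''job'' = t1 ''job''" "t ''num'' = t1 ''num''"
                "t ''den'' = t1 ''den''" "t ''V'' = t2 ''V''" "t ''PA'' = t3 ''PA''"
                "t ''PB'' = t3 ''PB''" "t ''G'' = t4 ''G''" "t ''next'' = t4 ''next''"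
                "t ''C'' = t5 ''C''" "t5 ''job'' = t1 ''job''" "t5 ''V'' = t2 ''V''"
                "t5 ''G'' = t4 ''G''"
                using fr[of "''g''"] g5
                  fr[of "''job''"] fr5[of "''job''"] fr4[of "''job''"]
                  fr[of "''num''"] fr5[of "''num''"] fr4[of "''num''"]
                  fr[of "''den''"] fr5[of "''den''"] fr4[of "''den''"]
                  fr[of "''V''"] fr5[of "''V''"] fr4[of "''V''"]
                  fr[of "''PA''"] fr5[of "''PA''"] fr4[of "''PA''"]
                  fr[of "''PB''"] fr5[of "''PB''"] fr4[of "''PB''"]
                  fr[of "''G''"] fr5[of "''G''"] fr[of "''next''"] fr5[of "''next''"]
                  fr[of "''C''"] e3 by simp_all
              have ps: "part_sum t = part_sum t2"
                by (rule part_sum_cong) (simp_all add: e e3)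
              have bb: "best_below t = best_below t3"
                by (rule best_below_cong) (simp_all add: e e3)
              have te: "time_entry t = time_entry t5"
                by (intro ext) (simp only: time_entry_def e)
              interpret final_store js t
              proof (unfold_locales, goal_cases)
                case 1
                show ?case by (rule js)
              next
                case (2 ops)
                then show ?case by (rule job)
              next
                case 3
                show ?case using t1 parsed_cong[of t t1 js ?n 0] e by simp
              next
                case 4
                show ?case using t1 unfolding e by blast
              next
                case 5
                show ?case using t1 unfolding e by metis
              next
                case (6 x)
                then show ?case using t2 unfolding e by blast
              next
                case 7
                show ?case using t2 unfolding e by blast
              next
                case (8 a)
                then show ?case using t3 unfolding e g2 ps by blast
              next
                case (9 a)
                then show ?case using t3 unfolding e g2 ps by blast
              next
                case 10
                show ?case using t4 unfolding e e3(1) by blast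
              next
                case (11 a)
                then show ?case using t4 unfolding e e3(1) bb by blast
              next
                case 12
                show ?case using t5 unfolding e by blast
              next
                case (13 h)
                then show ?case using t5 unfolding e n4 by blast
              qed
              have I': "machines I = 2" "jobs I = js" using I(2) by (simp_all add: js_def)
              have out: "t ''output'' 0 = t ''g'' 0 - 1 + 4 * ?n"
                using t unfolding e g5 n5 by blast
              have modes: "t ''output'' i = 1 - (t ''C'' (t ''job'' i) - i)" if "i \<in> {1..<t ''g'' 0}" for i
                using t that unfolding e g5 by blast
              have times: "t ''output'' (t ''g'' 0 + 4 * h + r) = time_entry t h r" if "h < ?n" "r < 4" for h r
                using t that unfolding e g5 n5 te by blast
              have "\<exists>S. encodes_schedule I S (output_words t) \<and> optimal_fixed_seq I S"
                by (rule optimal_answer[OF I' out modes times])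
              moreover have "t ''output'' 0 = offset js ?n + 4 * ?n"
                using out end_position by simp
              ultimately show ?case unfolding solved_def I' by blast
            qed (use Z in simp)
          qed (use Z in simp)
        qed (use Z in simp_all)
      qed (use Z in simp)
    qed (use Z in simp)
  qed (use Z in simp_all)
qed

lemma bits_list_ge:
  "x \<in> set xs \<Longrightarrow> bits x \<le> bits_list xs" "length xs \<le> bits_list xs"
proof -
  show "x \<in> set xs \<Longrightarrow> bits x \<le> bits_list xs"
    unfolding bits_list_def by (rule member_le_sum_list) auto
  show "length xs \<le> bits_list xs"
    unfolding bits_list_def by (induction xs) (auto simp: bits_def)
qed

lemma bits_list_le: "(\<And>x. x \<in> set xs \<Longrightarrow> bits x \<le> b) \<Longrightarrow> bits_list xs \<le> length xs * b"
  unfolding bits_list_def by (induction xs) (auto intro: add_mono)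

text \<open>Each operation and each job takes at least one word, so the input length can play the
  role of \<open>W\<close>.\<close>

lemma offset_le_length_encode:
  "offset js (length js) + length js \<le> length (concat (map encode_job js))"
proof (induction js)
  case (Cons ops js)
  have "length ops \<le> length (concat (map encode_operation ops))"
  proof (induction ops)
    case (Cons x ops)
    have "1 \<le> length (encode_operation x)" by (cases x) auto
    then show ?case using Cons by simp
  qed simp
  then show ?case using Cons by (simp add: offset_def encode_job_def)
qed (simp add: offset_def)

theorem theorem2:
  shows "poly_time_solvable
    {I. fixb_instance I \<and> machines I = 2}
    encode_fixb
    (\<lambda>I ys. \<exists>S. encodes_schedule I S ys \<and> optimal_fixed_seq I S)"
  unfolding poly_time_solvable_def
\<comment> \<open>The first factor bounds the number of steps plus that of output words, the second
  the length of a value and the cost of a step.\<close>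
proof (intro exI[of _ solve] exI[of _ "(monom 4000 2 + monom 4 1) *
    ((1 + monom 4000 2) * (monom 1 1 + 5))"] ballI)
  fix I assume "I \<in> {I. fixb_instance I \<and> machines I = 2}"
  then have I: "fixb_instance I" "machines I = 2" by auto
  define xs where "xs = encode_fixb I"
  define L where "L = bits_list xs"
  let ?s = "input_store xs"
  have xs: "xs = [2, njobs I] @ concat (map encode_job (jobs I))"
    using I(2) by (simp add: xs_def encode_fixb_def)
  have L: "offset (jobs I) (njobs I) + njobs I + 2 \<le> L"
    using bits_list_ge(2)[of xs] offset_le_length_encode[of "jobs I"] by (simp add: L_def xs)
  have "readable ?s 1 xs" by (simp add: readable_def input_store_def)
  then have r: "readable ?s 1 [2, njobs I]" "readable ?s 3 (concat (map encode_job (jobs I)))"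
    unfolding xs readable_append by (simp_all add: numeral_3_eq_3)
  have "?s ''input'' 2 = njobs I" using r(1)[unfolded readable_def, rule_format, of 1]
    by (simp add: numeral_2_eq_2)
  moreover have "?s x = (\<lambda>_. 0)" if "x \<noteq> ''input''" for x
    using that by (simp add: input_store_def)
  ultimately have "runs solve (4000 * (L * L)) (solved I) ?s"
    using I r(2) L by (intro runs_solve) auto
  then obtain k t where k: "k \<le> 4000 * (L * L)" and run: "run solve ?s k t" and t: "solved I t"
    unfolding runs_def by blast
  have small: "?s x i < 2 ^ (L + 3)" for x i
  proof -
    have "(length xs # xs) ! i < 2 ^ L" if "i \<le> length xs"
    proof (cases i)
      case 0
      have "length xs < 2 ^ length xs" by simp
      also have "\<dots> \<le> 2 ^ L" using bits_list_ge(2)[of xs] by (simp add: L_def)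
      finally show ?thesis using 0 by simp
    next
      case (Suc j)
      then have "xs ! j \<in> set xs" using that by simp
      have "xs ! j < 2 ^ bits (xs ! j)" by (rule less_power_bits)
      also have "\<dots> \<le> 2 ^ L" using bits_list_ge(1)[OF \<open>xs ! j \<in> set xs\<close>] by (simp add: L_def)
      finally show ?thesis using Suc by simp
    qed
    moreover have "(2::nat) ^ L \<le> 2 ^ (L + 3)" by (rule power_increasing) simp_all
    ultimately show ?thesis by (auto simp: input_store_def intro: less_le_trans)
  qed
  \<comment> \<open>The input length serves for both parameters; the added 3 satisfies
    \<open>3 \<le> B\<close>.\<close>
  have bounded: "store_bounded (L + 3) (L + 3) ?s" using small by (simp add: store_bounded_def)
  define Y where "Y = (1 + k) * (L + 5)"
  have Y: "L + 3 + Suc (L + 3) * k + 2 \<le> Y" by (simp add: Y_def algebra_simps)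
  obtain c where bt: "store_bounded (L + 3) (L + 3 + Suc (L + 3) * k) t" and c: "exec solve ?s c t"
    "c \<le> k * (L + 3 + Suc (L + 3) * k + 2)"
    using run_exec[OF run tame_solve bounded] by auto
  have "c \<le> k * Y" using c(2) Y by (meson le_trans mult_le_mono2)
  moreover have "bits_list (output_words t) \<le> (4 * L) * Y"
  proof -
    have "bits x \<le> Y" if "x \<in> set (output_words t)" for x
    proof -
      have "x < 2 ^ (L + 3 + Suc (L + 3) * k)"
        using that bt by (auto simp: output_words_def store_bounded_def)
      from bits_le_if_less_power[OF this] show ?thesis using Y by simp
    qed
    from bits_list_le[OF this] have "bits_list (output_words t) \<le> length (output_words t) * Y" .
    also have "length (output_words t) = t ''output'' 0"
      by (simp add: output_words_def del: upt_Suc)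
    \<comment> \<open>An operation yields one output word and a position four.\<close>
    also have "\<dots> \<le> 4 * L" using t L by (simp add: solved_def)
    finally show ?thesis by simp
  qed
  ultimately have "c + bits_list (output_words t) \<le> (k + 4 * L) * Y"
    by (simp add: add_mult_distrib)
  also have "\<dots> \<le> (4000 * (L * L) + 4 * L) * ((1 + 4000 * (L * L)) * (L + 5))"
    unfolding Y_def using k by (intro mult_le_mono add_le_mono) auto
  also have "\<dots> = poly ((monom 4000 2 + monom 4 1) *
      ((1 + monom 4000 2) * (monom 1 1 + 5))) L"
    by (simp add: poly_monom power2_eq_square algebra_simps)
  finally show "\<exists>c t. exec solve (input_store (encode_fixb I)) c t \<and>
      c + bits_list (output_words t) \<le> poly ((monom 4000 2 + monom 4 1) *
        ((1 + monom 4000 2) * (monom 1 1 + 5))) (bits_list (encode_fixb I)) \<and>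
      (\<exists>S. encodes_schedule I S (output_words t) \<and> optimal_fixed_seq I S)"
    using c(1) t unfolding xs_def L_def solved_def by blast
qed

end
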